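(* Let $\Sigma$ be a polyhedral fan in $\mathbb{R}^d$ with face poset $\mathcal{F}(\Sigma)$. Let $\mathcal{G}\subseteq\mathcal{F}(\Sigma)$ be a building set of $\mathcal{F}(\Sigma)$ and $\mathcal{N}(\mathcal{G})$ the complex of nested sets in $\mathcal{G}$. Then the consecutive application of stellar subdivisions in every cone $G\in\mathcal{G}$, in a non-increasing order (i.e. $G$ is subdivided before $G'$ whenever $G\supsetneq G'$), yields a simplicial subdivision of $\Sigma$ whose face poset is equal (isomorphic) to the face poset of $\mathcal{N}(\mathcal{G})$ (including the empty face).
   Context: A polyhedral fan is a finite collection of closed pointed polyhedral cones in $\mathbb{R}^d$, closed under taking faces and such that the intersection of any two cones is a common face of both. Its face poset $\mathcal{F}(\Sigma)$ is the set of cones of $\Sigma$ ordered by inclusion, with minimal element $\hat 0=\{0\}$; it is a finite meet-semilattice. A fan is simplicial if each of its cones is generated by linearly independent vectors. Stellar subdivision: for $\tau\in\Sigma$, $\tau\neq\{0\}$, and $x\in\mathrm{relint}\,\tau$, let $\mathrm{star}(\tau,\Sigma)=\{\sigma\in\Sigma\mid\tau\subseteq\sigma\}$. The stellar subdivision of $\Sigma$ in $x$ is the collection of cones $$(\Sigma\setminus\mathrm{star}(\tau,\Sigma))\cup\{\mathrm{cone}(x,\rho)\mid\rho\in\Sigma\setminus\mathrm{star}(\tau,\Sigma),\ \rho\subseteq\sigma\text{ for some }\sigma\in\mathrm{star}(\tau,\Sigma)\},$$ where $\mathrm{cone}(x,\rho)$ is the closed polyhedral cone spanned by $\rho$ and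 $x$. A stellar subdivision in $\tau$ is any stellar subdivision in some $x\in\mathrm{relint}\,\tau$. In a finite meet-semilattice $\mathcal{L}$ with minimal element $\hat 0$, any subset with an upper bound has a join (least upper bound). A subset $\mathcal{G}\subseteq\mathcal{L}\setminus\{\hat 0\}$ is a building set of $\mathcal{L}$ if for any $x\in\mathcal{L}\setminus\{\hat 0\}$, with $\{x_1,\dots,x_k\}$ the set of maximal elements of $\mathcal{G}_{\le x}=\{y\in\mathcal{G}\mid y\le x\}$, there is an isomorphism of posets $\varphi_x:\prod_{j=1}^k[\hat 0,x_j]\to[\hat 0,x]$ with $\varphi_x(\hat 0,\dots,x_j,\dots,\hat 0)=x_j$ for all $j$. A subset $N\subseteq\mathcal{G}$ is nested if for any set of pairwise incomparable elements $x_1,\dots,x_t\in N$ of cardinality at least two, the join $x_1\vee\dots\vee x_t$ exists in $\mathcal{L}$ and does not belong to $\mathcal{G}$. The nested subsets form an abstract simplicial complex $\mathcal{N}(\mathcal{G})$. *)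

theory Defs
  imports "HOL-Analysis.Analysis" "HOL-Library.FuncSet"
begin

section \<open>Finite posets, building sets and nested sets\<close>

text \<open>A poset is given by a carrier set in a type of class \<open>order\<close>. For a fan the type is
  \<open>'a set\<close>, so that the order is inclusion; for nested sets it is inclusion as well, one
  level up; for products it is the pointwise order on functions.\<close>

definition order_iso :: "('a::order \<Rightarrow> 'b::order) \<Rightarrow> 'a set \<Rightarrow> 'b set \<Rightarrow> bool" where
  "order_iso f A B \<longleftrightarrow> bij_betw f A B \<and> (\<forall>x\<in>A. \<forall>y\<in>A. x \<le> y \<longleftrightarrow> f x \<le> f y)"

definition order_isomorphic :: "'a::order set \<Rightarrow> 'b::order set \<Rightarrow> bool" where
  "order_isomorphic A B \<longleftrightarrow> (\<exists>f. order_iso f A B)"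

definition bottom :: "'a::order set \<Rightarrow> 'a" where
  "bottom L = (LEAST z. z \<in> L)"

definition lower_interval :: "'a::order set \<Rightarrow> 'a \<Rightarrow> 'a set" where
  "lower_interval L x = {z \<in> L. z \<le> x}"

definition is_join :: "'a::order set \<Rightarrow> 'a set \<Rightarrow> 'a \<Rightarrow> bool" where
  "is_join L A z \<longleftrightarrow>
     z \<in> L \<and> (\<forall>a\<in>A. a \<le> z) \<and> (\<forall>w\<in>L. (\<forall>a\<in>A. a \<le> w) \<longrightarrow> z \<le> w)"

text \<open>The set of maximal elements of \<open>{y \<in> G. y \<le> x}\<close>.\<close>

definition factors :: "'a::order set \<Rightarrow> 'a \<Rightarrow> 'a set" where
  "factors G x = {y \<in> G. y \<le> x \<and> \<not> (\<exists>z\<in>G. z \<le> x \<and> y < z)}"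

text \<open>The product of the lower intervals is the extensional dependent product \<open>PiE\<close>
  indexed by the factors themselves. All its elements agree outside the index set, so the
  order on functions restricts to the componentwise order. The product over no factors has
  exactly one element.\<close>

definition building_set :: "'a::order set \<Rightarrow> 'a set \<Rightarrow> bool" where
  "building_set L G \<longleftrightarrow>
     G \<subseteq> L - {bottom L} \<and>
     (\<forall>x \<in> L - {bottom L}. \<exists>\<phi>.
        order_iso \<phi> (\<Pi>\<^sub>E y\<in>factors G x. lower_interval L y) (lower_interval L x) \<and>
        (\<forall>y\<in>factors G x. \<phi> (\<lambda>z\<in>factors G x. if z = y then y else bottom L) = y))"

definition nested :: "'a::order set \<Rightarrow> 'a set \<Rightarrow> 'a set \<Rightarrow> bool" where
  "nested L G N \<longleftrightarrow>
     N \<subseteq> G \<and>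
     (\<forall>A \<subseteq> N. card A \<ge> 2 \<and> (\<forall>a\<in>A. \<forall>b\<in>A. a \<noteq> b \<longrightarrow> \<not> a \<le> b) \<longrightarrow>
        (\<exists>z. is_join L A z \<and> z \<notin> G))"

definition nested_complex :: "'a::order set \<Rightarrow> 'a set \<Rightarrow> 'a set set" where
  "nested_complex L G = {N. nested L G N}"

section \<open>Polyhedral fans\<close>

definition pointed_polyhedral_cone :: "'a::euclidean_space set \<Rightarrow> bool" where
  "pointed_polyhedral_cone C \<longleftrightarrow>
     polyhedron C \<and> convex_cone C \<and> C \<inter> uminus ` C = {0}"

text \<open>The relation \<open>face_of\<close> counts the empty set as a face, which has to be excluded for
  cones. A fan is required to be nonempty; it then contains \<open>{0}\<close> as its least cone.\<close>

definition polyhedral_fan :: "'a::euclidean_space set set \<Rightarrow> bool" where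
  "polyhedral_fan \<Sigma> \<longleftrightarrow>
     finite \<Sigma> \<and> \<Sigma> \<noteq> {} \<and>
     (\<forall>\<sigma>\<in>\<Sigma>. pointed_polyhedral_cone \<sigma>) \<and>
     (\<forall>\<sigma>\<in>\<Sigma>. \<forall>\<tau>. \<tau> face_of \<sigma> \<and> \<tau> \<noteq> {} \<longrightarrow> \<tau> \<in> \<Sigma>) \<and>
     (\<forall>\<sigma>\<in>\<Sigma>. \<forall>\<tau>\<in>\<Sigma>. (\<sigma> \<inter> \<tau>) face_of \<sigma> \<and> (\<sigma> \<inter> \<tau>) face_of \<tau>)"

definition simplicial_fan :: "'a::euclidean_space set set \<Rightarrow> bool" where
  "simplicial_fan \<Sigma> \<longleftrightarrow>
     polyhedral_fan \<Sigma> \<and> (\<forall>\<sigma>\<in>\<Sigma>. \<exists>B. independent B \<and> \<sigma> = convex_cone hull B)"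

definition fan_subdivision :: "'a::euclidean_space set set \<Rightarrow> 'a set set \<Rightarrow> bool" where
  "fan_subdivision \<Sigma>' \<Sigma> \<longleftrightarrow>
     polyhedral_fan \<Sigma>' \<and> \<Union>\<Sigma>' = \<Union>\<Sigma> \<and> (\<forall>\<sigma>'\<in>\<Sigma>'. \<exists>\<sigma>\<in>\<Sigma>. \<sigma>' \<subseteq> \<sigma>)"

section \<open>Stellar subdivisions\<close>

definition star :: "'a set \<Rightarrow> 'a set set \<Rightarrow> 'a set set" where
  "star \<tau> \<Sigma> = {\<sigma>\<in>\<Sigma>. \<tau> \<subseteq> \<sigma>}"

definition stellar_subdivision ::
    "'a::euclidean_space set set \<Rightarrow> 'a set \<Rightarrow> 'a \<Rightarrow> 'a set set" where
  "stellar_subdivision \<Sigma> \<tau> x =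
     (\<Sigma> - star \<tau> \<Sigma>) \<union>
     {convex_cone hull (insert x \<rho>) | \<rho>. \<rho> \<in> \<Sigma> - star \<tau> \<Sigma> \<and> (\<exists>\<sigma>\<in>star \<tau> \<Sigma>. \<rho> \<subseteq> \<sigma>)}"

text \<open>The stellar subdivision of \<open>\<Sigma>\<close> in a point \<open>x\<close> of the relative interior of \<open>\<tau>\<close> makes
  sense when the following holds.\<close>

definition stellar_admissible ::
    "'a::euclidean_space set set \<Rightarrow> 'a set \<Rightarrow> 'a \<Rightarrow> bool" where
  "stellar_admissible \<Sigma> \<tau> x \<longleftrightarrow>
     polyhedral_fan \<Sigma> \<and> \<tau> \<in> \<Sigma> \<and> \<tau> \<noteq> {0} \<and> x \<in> rel_interior \<tau>"

text \<open>Stellar subdivision in the cones of a list, the head of the list first, where a cone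
  \<open>G\<close> is subdivided in the point \<open>p G\<close>.\<close>

primrec stellar_subdivisions ::
    "('a::euclidean_space set \<Rightarrow> 'a) \<Rightarrow> 'a set list \<Rightarrow> 'a set set \<Rightarrow> 'a set set" where
  "stellar_subdivisions p [] \<Sigma> = \<Sigma>"
| "stellar_subdivisions p (G # Gs) \<Sigma> =
     stellar_subdivisions p Gs (stellar_subdivision \<Sigma> G (p G))"

definition nonincreasing_enumeration :: "'a::order set \<Rightarrow> 'a list \<Rightarrow> bool" where
  "nonincreasing_enumeration G Gs \<longleftrightarrow>
     set Gs = G \<and> distinct Gs \<and>
     (\<forall>i<length Gs. \<forall>j<length Gs. Gs ! j < Gs ! i \<longrightarrow> i < j)"

section \<open>The least element of a fan\<close>

lemma zero_in_polyhedral_fan: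
  assumes "polyhedral_fan \<Sigma>"
  shows "{0} \<in> \<Sigma>"
proof -
  obtain \<sigma> where \<sigma>: "\<sigma> \<in> \<Sigma>" "pointed_polyhedral_cone \<sigma>"
    using assms unfolding polyhedral_fan_def by blast
  have cc: "convex_cone \<sigma>" and pt: "\<sigma> \<inter> uminus ` \<sigma> = {0}"
    using \<sigma>(2) unfolding pointed_polyhedral_cone_def by auto
  have "a = 0 \<and> b = 0"
    if a: "a \<in> \<sigma>" and b: "b \<in> \<sigma>" and z: "0 \<in> open_segment a b" for a b
  proof -
    from z obtain u where u: "0 < u" "u < 1" "0 = (1 - u) *\<^sub>R a + u *\<^sub>R b"
      by (auto simp: in_segment)
    let ?c = "(1 - u) *\<^sub>R a"
    have "?c = - (u *\<^sub>R b)"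
      using u(3) by (metis eq_neg_iff_add_eq_0)
    moreover have "?c \<in> \<sigma>" "u *\<^sub>R b \<in> \<sigma>"
      using a b u cc by (auto intro: convex_cone_scaleR)
    ultimately have "?c \<in> \<sigma> \<inter> uminus ` \<sigma>"
      by auto
    then have "?c = 0" using pt by auto
    then show ?thesis using u by auto
  qed
  moreover have "0 \<in> \<sigma>" using cc by (rule convex_cone_contains_0)
  ultimately have "{0} face_of \<sigma>"
    unfolding face_of_def by auto
  then show ?thesis
    using assms \<sigma>(1) unfolding polyhedral_fan_def by blast
qed

lemma bottom_polyhedral_fan:
  assumes "polyhedral_fan \<Sigma>"
  shows "bottom \<Sigma> = {0}"
  unfolding bottom_def
proof (rule Least_equality)
  show "{0} \<in> \<Sigma>" using assms by (rule zero_in_polyhedral_fan)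
  show "{0} \<le> \<sigma>" if "\<sigma> \<in> \<Sigma>" for \<sigma>
    using assms that convex_cone_contains_0
    unfolding polyhedral_fan_def pointed_polyhedral_cone_def by blast
qed

end

theory Submission
  imports Defs
begin

text \<open>
  A building set is turned into a geometric condition: every cone of the fan is the direct sum of
  its factors. This condition is inherited by the stellar subdivision in a maximal element
  \<open>\<tau>\<close> of the building set, when \<open>\<tau>\<close> is replaced by the new ray: the new cones are direct sums of
  the ray and an old cone. Nestedness means that every antichain in the set is the set of factors
  of some cone, and it is also unchanged by that replacement. In the end the building set
  consists of rays, every cone is the direct sum of the rays it contains, and the nested sets are
  the sets of rays of cones.
\<close>

section \<open>Faces of cones\<close>

text \<open>The hypothesis on the building set is purely order-theoretic, whereas stellar
  subdivision acts on cones as sets. An isomorphism from a product of face posets onto the faces of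
  \<sigma> does not visibly decompose \<sigma> as a cone; closedness and pointedness are needed to
  force this. That argument is carried out once, for the original fan, and no poset isomorphism has
  to be transported afterwards. Each step requires \<tau> to be maximal when its turn comes. The
  order of the list secures this against the cones still to come. A cone treated earlier has become
  a ray, and such a ray contains no remaining cone: a nonzero cone inside it would contain its
  generating point and therefore the cone that was subdivided. Conversely a remaining cone never
  contains \<tau>, so it survives each subdivision as the same set, and its chosen point stays in
  its relative interior. Joins are hard to follow through a subdivision, since the cone that
  realizes a join may be removed. Sets of factors are easy to follow, because those of every new
  cone can be computed.\<close>

lemma convex_coneI:
  assumes "0 \<in> S" "\<And>x y. x \<in> S \<Longrightarrow> y \<in> S \<Longrightarrow> x + y \<in> S"
    "\<And>x c. x \<in> S \<Longrightarrow> c \<ge> 0 \<Longrightarrow> c *\<^sub>R x \<in> S"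
  shows "convex_cone S"
  using assms unfolding convex_cone_iff by blast

lemma convex_cone_sum:
  assumes "convex_cone S" "\<And>a. a \<in> A \<Longrightarrow> f a \<in> S"
  shows "sum f A \<in> S"
  using assms
  by (induction A rule: infinite_finite_induct)
    (auto simp: convex_cone_contains_0 convex_cone_add)

text \<open>Scaling is free inside a cone, so the weights of a convex combination can be absorbed
  into its end points, and the segment condition becomes absorption of summands. Nonemptiness
  excludes the empty face, which lacks 0.\<close>

lemma face_of_cone_iff:
  assumes C: "convex_cone C" and ne: "F \<noteq> {}"
  shows "F face_of C \<longleftrightarrow>
    convex_cone F \<and> F \<subseteq> C \<and> (\<forall>a\<in>C. \<forall>b\<in>C. a + b \<in> F \<longrightarrow> a \<in> F)" (is "?L \<longleftrightarrow> ?R")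
proof
  assume L: ?L
  then have sub: "F \<subseteq> C" and conv: "convex F"
    and fd: "\<And>a b x. a \<in> C \<Longrightarrow> b \<in> C \<Longrightarrow> x \<in> F \<Longrightarrow> x \<in> open_segment a b \<Longrightarrow> a \<in> F \<and> b \<in> F"
    unfolding face_of_def by blast+
  have 0: "0 \<in> F"
  proof -
    obtain x where x: "x \<in> F" using ne by blast
    show ?thesis
    proof (cases "x = 0")
      case False
      \<comment> \<open>\<open>x\<close> is the midpoint of 0 and \<open>2 *\<^sub>R x\<close>, so
        the face property puts 0 into \<open>F\<close>.\<close>
      have "x = (1 - 1/2) *\<^sub>R 0 + (1/2) *\<^sub>R (2 *\<^sub>R x)" by simp
      then have "x \<in> open_segment 0 (2 *\<^sub>R x)"
        unfolding in_segment using False by (intro conjI exI[of _ "1/2"]) auto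
      moreover have "2 *\<^sub>R x \<in> C" "0 \<in> C"
        using x sub C by (auto intro: convex_cone_scaleR convex_cone_contains_0)
      ultimately show ?thesis using fd x by blast
    qed (use x in simp)
  qed
  have scale: "c *\<^sub>R x \<in> F" if x: "x \<in> F" and c: "c \<ge> 0" for x c
  proof (cases "c \<le> 1 \<or> x = 0")
    case True
    then have "(1 - c) *\<^sub>R 0 + c *\<^sub>R x \<in> F" using 0 x c conv
      by (cases "x = 0") (auto intro: convexD_alt[OF conv 0 x, simplified])
    then show ?thesis by simp
  next
    case False
    \<comment> \<open>For \<open>c > 1\<close> the point \<open>x\<close> lies strictly between 0
      and \<open>c *\<^sub>R x\<close>.\<close>
    then have "x = (1 - 1/c) *\<^sub>R 0 + (1/c) *\<^sub>R (c *\<^sub>R x)" "0 < 1/c" "1/c < 1" by auto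
    then have "x \<in> open_segment 0 (c *\<^sub>R x)"
      unfolding in_segment using False by (intro conjI exI[of _ "1/c"]) auto
    moreover have "c *\<^sub>R x \<in> C" "0 \<in> C"
      using x sub C c by (auto intro: convex_cone_scaleR convex_cone_contains_0)
    ultimately show ?thesis using fd x by blast
  qed
  have add: "x + y \<in> F" if "x \<in> F" "y \<in> F" for x y
  proof -
    have "(1 - 1/2) *\<^sub>R x + (1/2) *\<^sub>R y \<in> F" using convexD_alt[OF conv that, of "1/2"] by simp
    then have "2 *\<^sub>R ((1 - 1/2) *\<^sub>R x + (1/2) *\<^sub>R y) \<in> F" using scale by simp
    then show ?thesis by (simp add: algebra_simps)
  qed
  have "a \<in> F" if a: "a \<in> C" and b: "b \<in> C" and ab: "a + b \<in> F" for a b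
  proof (cases "a = b")
    case True
    then have "(1/2) *\<^sub>R (a + b) = a" by (simp add: scaleR_2[symmetric])
    then show ?thesis using scale[OF ab, of "1/2"] by simp
  next
    case False
    then have "(1/2) *\<^sub>R (a + b) \<in> open_segment a b"
      unfolding in_segment by (intro conjI exI[of _ "1/2"]) (auto simp: algebra_simps)
    then show ?thesis using fd[OF a b scale[OF ab, of "1/2"]] by simp
  qed
  moreover have "convex_cone F" by (rule convex_coneI) (fact 0 add scale)+
  ultimately show ?R using sub by blast
next
  assume R: ?R
  then have F: "convex_cone F" and sub: "F \<subseteq> C"
    and fd: "\<And>a b. a \<in> C \<Longrightarrow> b \<in> C \<Longrightarrow> a + b \<in> F \<Longrightarrow> a \<in> F" by blast+
  have "a \<in> F \<and> b \<in> F" if a: "a \<in> C" and b: "b \<in> C" and x: "x \<in> F" "x \<in> open_segment a b" for a b x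
  proof -
    obtain u where u: "0 < u" "u < 1" "x = (1 - u) *\<^sub>R a + u *\<^sub>R b"
      using x by (auto simp: in_segment)
    have ua: "(1 - u) *\<^sub>R a \<in> C" "u *\<^sub>R b \<in> C" using a b u C by (auto intro: convex_cone_scaleR)
    have 1: "(1 - u) *\<^sub>R a \<in> F" using fd[OF ua] u x by simp
    have 2: "u *\<^sub>R b \<in> F" using fd[OF ua(2,1)] u x by (simp add: add.commute)
    have "(1/(1-u)) *\<^sub>R ((1 - u) *\<^sub>R a) \<in> F" "(1/u) *\<^sub>R (u *\<^sub>R b) \<in> F"
      using u 1 2 F by (auto intro!: convex_cone_scaleR simp del: scaleR_scaleR)
    then show ?thesis using u by simp
  qed
  then show ?L using F sub unfolding face_of_def convex_cone_def by blast
qed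

lemma face_of_coneD:
  assumes "F face_of C" "F \<noteq> {}" "convex_cone C"
  shows "convex_cone F" "F \<subseteq> C"
    and "\<And>a b. a \<in> C \<Longrightarrow> b \<in> C \<Longrightarrow> a + b \<in> F \<Longrightarrow> a \<in> F"
    and "\<And>a b. a \<in> C \<Longrightarrow> b \<in> C \<Longrightarrow> a + b \<in> F \<Longrightarrow> b \<in> F"
proof -
  have F: "convex_cone F \<and> F \<subseteq> C \<and> (\<forall>a\<in>C. \<forall>b\<in>C. a + b \<in> F \<longrightarrow> a \<in> F)"
    using assms face_of_cone_iff[of C F] by simp
  then show "convex_cone F" "F \<subseteq> C" by simp_all
  show 1: "a \<in> F" if "a \<in> C" "b \<in> C" "a + b \<in> F" for a b using F that by blast
  show "b \<in> F" if "a \<in> C" "b \<in> C" "a + b \<in> F" for a b using 1[of b a] that by (simp add: add.commute)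
qed

text \<open>For a convex cone \<open>C\<close> and \<open>u\<close> in it, this is the smallest face
  containing \<open>u\<close>: the points dominated by a multiple of \<open>u\<close> in the
  preorder induced by \<open>C\<close>.\<close>

definition min_face :: "'a::real_vector set \<Rightarrow> 'a \<Rightarrow> 'a set" where
  "min_face C u = {v \<in> C. \<exists>c\<ge>0. c *\<^sub>R u - v \<in> C}"

lemma min_face:
  assumes C: "convex_cone C" and u: "u \<in> C"
  shows "min_face C u face_of C" "u \<in> min_face C u"
proof -
  show uu: "u \<in> min_face C u"
    using C u convex_cone_contains_0[OF C] unfolding min_face_def
    by (auto intro!: exI[of _ 1])
  have "convex_cone (min_face C u)"
  proof (rule convex_coneI)
    show "0 \<in> min_face C u"
      using convex_cone_contains_0[OF C] unfolding min_face_def by (auto intro!: exI[of _ 0])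
    fix x y assume "x \<in> min_face C u" "y \<in> min_face C u"
    then obtain c d where "x \<in> C" "y \<in> C" "c \<ge> 0" "d \<ge> 0" "c *\<^sub>R u - x \<in> C" "d *\<^sub>R u - y \<in> C"
      unfolding min_face_def by blast
    moreover have "(c + d) *\<^sub>R u - (x + y) = (c *\<^sub>R u - x) + (d *\<^sub>R u - y)"
      by (simp add: algebra_simps)
    ultimately have "(c + d) *\<^sub>R u - (x + y) \<in> C" "x + y \<in> C" "c + d \<ge> 0"
      using convex_cone_add[OF C] by (metis, metis, linarith)
    then show "x + y \<in> min_face C u" unfolding min_face_def by blast
  next
    fix x k assume "x \<in> min_face C u" "k \<ge> (0::real)"
    then obtain c where "x \<in> C" "c \<ge> 0" "c *\<^sub>R u - x \<in> C" "k \<ge> 0"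
      unfolding min_face_def by blast
    moreover have "(k * c) *\<^sub>R u - k *\<^sub>R x = k *\<^sub>R (c *\<^sub>R u - x)"
      by (simp add: algebra_simps)
    ultimately show "k *\<^sub>R x \<in> min_face C u"
      unfolding min_face_def using C
      by (auto intro!: convex_cone_scaleR exI[of _ "k*c"] simp del: scaleR_scaleR)
  qed
  moreover have "a \<in> min_face C u" if ab: "a \<in> C" "b \<in> C" "a + b \<in> min_face C u" for a b
  proof -
    obtain c where "c \<ge> 0" "c *\<^sub>R u - (a + b) \<in> C" using ab(3) unfolding min_face_def by auto
    moreover have "c *\<^sub>R u - a = (c *\<^sub>R u - (a + b)) + b" by simp
    ultimately have "c *\<^sub>R u - a \<in> C" using convex_cone_add[OF C] that by metis
    then show ?thesis using \<open>c \<ge> 0\<close> that unfolding min_face_def by blast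
  qed
  ultimately show "min_face C u face_of C"
    using uu by (subst face_of_cone_iff[OF C]) (auto simp: min_face_def)
qed

text \<open>If one multiple of \<open>u\<close> dominates \<open>v\<close>, so do all larger ones. A
  threshold instead of a single factor lets finitely many such bounds be met by a common
  \<open>d\<close>; passing to \<open>c + 1\<close> makes it positive.\<close>

lemma min_face_scale_bound:
  assumes C: "convex_cone C" and u: "u \<in> C" and v: "v \<in> min_face C u"
  obtains c where "c > 0" "\<And>d. d \<ge> c \<Longrightarrow> d *\<^sub>R u - v \<in> C"
proof -
  obtain c where c: "c \<ge> 0" "c *\<^sub>R u - v \<in> C" using v unfolding min_face_def by blast
  have "d *\<^sub>R u - v \<in> C" if "d \<ge> c + 1" for d
  proof -
    have "(c *\<^sub>R u - v) + (d - c) *\<^sub>R u \<in> C"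
      using that c C u by (intro convex_cone_add convex_cone_scaleR) auto
    then show ?thesis by (simp add: algebra_simps)
  qed
  then show ?thesis using c that[of "c + 1"] by auto
qed

lemma pointed_coneD:
  assumes "pointed_polyhedral_cone C"
  shows "convex_cone C" "closed C" "polyhedron C" "\<And>x. x \<in> C \<Longrightarrow> -x \<in> C \<Longrightarrow> x = 0"
proof -
  show "convex_cone C" "polyhedron C" using assms unfolding pointed_polyhedral_cone_def by auto
  then show "closed C" by (simp add: polyhedron_imp_closed)
  have "C \<inter> uminus ` C = {0}" using assms unfolding pointed_polyhedral_cone_def by auto
  then show "\<And>x. x \<in> C \<Longrightarrow> -x \<in> C \<Longrightarrow> x = 0" by force
qed

text \<open>Subtract the largest multiple of \<open>x\<close> that keeps the point inside
  \<open>C\<close>. The supremum is finite because \<open>C\<close> is pointed and attained because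
  \<open>C\<close> is closed; there, \<open>x\<close> lies outside the minimal face of the
  remainder.\<close>

lemma push_to_face:
  fixes C :: "'a::euclidean_space set"
  assumes C: "pointed_polyhedral_cone C" and x: "x \<in> C" "x \<noteq> 0" and y: "y \<in> C"
  obtains a F where "a \<ge> 0" "F face_of C" "y - a *\<^sub>R x \<in> F" "x \<notin> F"
proof -
  note CC = pointed_coneD[OF C]
  define T where "T = {a. y - a *\<^sub>R x \<in> C} \<inter> {0..}"
  have clT: "closed T" unfolding T_def
    using continuous_closed_vimage[OF CC(2), of "\<lambda>a. y - a *\<^sub>R x"]
    by (intro closed_Int closed_atLeast) (auto simp: vimage_def intro!: continuous_intros)
  have T0: "0 \<in> T" using y by (simp add: T_def)
  have bdd: "bdd_above T"
  proof (rule ccontr)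
    assume nb: "\<not> bdd_above T"
    have "\<exists>a\<in>T. a > real (Suc n)" for n using nb unfolding bdd_above_def by (metis not_le)
    then obtain f where f: "\<And>n. f n \<in> T" "\<And>n. f n > real (Suc n)" by metis
    \<comment> \<open>Dividing \<open>y - a *\<^sub>R x\<close> by unbounded values of
      \<open>a\<close> leaves \<open>- x\<close> in the limit, which pointedness forbids.\<close>
    have "(1 / f n) *\<^sub>R y - x \<in> C" for n
    proof -
      have p: "f n > 0" using f(2)[of n] by linarith
      then have "(1 / f n) *\<^sub>R (y - f n *\<^sub>R x) \<in> C" using f(1)[of n] CC(1)
        by (intro convex_cone_scaleR) (auto simp: T_def)
      then show ?thesis using p by (simp add: scaleR_diff_right)
    qed
    moreover have "(\<lambda>n. (1 / f n) *\<^sub>R y - x) \<longlonglongrightarrow> 0 *\<^sub>R y - x"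
    proof (intro tendsto_intros)
      show "(\<lambda>n. 1 / f n) \<longlonglongrightarrow> 0"
      proof (rule tendsto_sandwich[of "\<lambda>n. 0" _ _ "\<lambda>n. 1 / real (Suc n)"])
        show "\<forall>\<^sub>F n in sequentially. 0 \<le> 1 / f n"
          using f(2) by (intro always_eventually allI) (smt (verit) divide_nonneg_nonneg of_nat_0_le_iff)
        show "\<forall>\<^sub>F n in sequentially. 1 / f n \<le> 1 / real (Suc n)"
          using f(2) by (intro always_eventually allI frac_le) (auto intro: less_imp_le)
        show "(\<lambda>n. 1 / real (Suc n)) \<longlonglongrightarrow> 0"
          using LIMSEQ_inverse_real_of_nat by (simp add: inverse_eq_divide)
      qed auto
    qed
    ultimately have "- x \<in> C" using closed_sequentially[OF CC(2)] by force
    then show False using CC(4) x by blast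
  qed
  define a where "a = Sup T"
  have aT: "a \<in> T" unfolding a_def using closed_contains_Sup[OF _ bdd clT] T0 by blast
  then have a: "a \<ge> 0" "y - a *\<^sub>R x \<in> C" by (auto simp: T_def)
  \<comment> \<open>If \<open>x\<close> were in this face, a further multiple \<open>1/c\<close> of
    it could be subtracted.\<close>
  have "x \<notin> min_face C (y - a *\<^sub>R x)"
  proof
    assume "x \<in> min_face C (y - a *\<^sub>R x)"
    then obtain c where c: "c > 0" "c *\<^sub>R (y - a *\<^sub>R x) - x \<in> C"
      using min_face_scale_bound[OF CC(1) a(2)] by (metis order_refl)
    then have "(1/c) *\<^sub>R (c *\<^sub>R (y - a *\<^sub>R x) - x) \<in> C"
      by (intro convex_cone_scaleR CC) auto
    moreover have "(1/c) *\<^sub>R (c *\<^sub>R (y - a *\<^sub>R x) - x) = y - (a + 1/c) *\<^sub>R x"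
      using c by (simp add: algebra_simps)
    ultimately have "a + 1/c \<in> T" using a c by (simp add: T_def)
    then have "a + 1/c \<le> a" unfolding a_def using cSup_upper[OF _ bdd] by blast
    then show False using c by simp
  qed
  then show ?thesis using that[OF a(1) min_face(1)[OF CC(1) a(2)] min_face(2)[OF CC(1) a(2)]] by blast
qed

section \<open>Joining a cone with a ray\<close>

lemma convex_cone_hull_insert:
  assumes "convex_cone \<rho>"
  shows "convex_cone hull (insert x \<rho>) = {a *\<^sub>R x + r | a r. a \<ge> 0 \<and> r \<in> \<rho>}" (is "_ = ?R")
proof
  show "convex_cone hull (insert x \<rho>) \<subseteq> ?R"
  proof (rule hull_minimal)
    show "insert x \<rho> \<subseteq> ?R"
    proof
      fix y assume "y \<in> insert x \<rho>"
      then consider "y = 1 *\<^sub>R x + 0" | "y = 0 *\<^sub>R x + y" "y \<in> \<rho>" by fastforce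
      then show "y \<in> ?R" using convex_cone_contains_0[OF assms] by cases (blast intro: zero_le_one order_refl)+
    qed
    show "convex_cone ?R"
    proof (rule convex_coneI)
      show "0 \<in> ?R" using convex_cone_contains_0[OF assms] by force
      fix y z assume "y \<in> ?R" "z \<in> ?R"
      then obtain a r b s where "y = a *\<^sub>R x + r" "z = b *\<^sub>R x + s" "a \<ge> 0" "b \<ge> 0" "r \<in> \<rho>" "s \<in> \<rho>"
        by blast
      then show "y + z \<in> ?R" using convex_cone_add[OF assms]
        by (auto intro!: exI[of _ "a+b"] exI[of _ "r+s"] simp: algebra_simps)
    next
      fix y c assume "y \<in> ?R" "(c::real) \<ge> 0"
      then obtain a r where "y = a *\<^sub>R x + r" "a \<ge> 0" "r \<in> \<rho>" by blast
      then show "c *\<^sub>R y \<in> ?R" using convex_cone_scaleR[OF assms] \<open>c \<ge> 0\<close>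
        by (auto intro!: exI[of _ "c*a"] exI[of _ "c *\<^sub>R r"] simp: algebra_simps)
    qed
  qed
  show "?R \<subseteq> convex_cone hull (insert x \<rho>)"
  proof clarify
    fix a r assume "(a::real) \<ge> 0" "r \<in> \<rho>"
    then show "a *\<^sub>R x + r \<in> convex_cone hull (insert x \<rho>)"
      by (intro convex_cone_hull_add convex_cone_hull_mul) (auto simp: hull_inc)
  qed
qed

lemma convex_cone_hull_singleton: "convex_cone hull {x} = {a *\<^sub>R x | a. a \<ge> 0}"
proof -
  have "convex_cone hull {x} = convex_cone hull (insert x {0})"
    by (intro subset_antisym hull_minimal)
      (auto simp: hull_inc convex_cone_hull_contains_0 convex_cone_convex_cone_hull)
  then show ?thesis by (simp add: convex_cone_hull_insert)
qed

lemma span_convex_cone: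
  assumes "convex_cone \<rho>" "v \<in> span \<rho>"
  obtains r s where "r \<in> \<rho>" "s \<in> \<rho>" "v = r - s"
proof -
  have "subspace {r - s | r s. r \<in> \<rho> \<and> s \<in> \<rho>}" (is "subspace ?D")
  proof (rule subspaceI)
    show "0 \<in> ?D" using convex_cone_contains_0[OF assms(1)] by force
    fix y z assume "y \<in> ?D" "z \<in> ?D"
    then obtain r s r' s' where "y = r - s" "z = r' - s'" "r \<in> \<rho>" "s \<in> \<rho>" "r' \<in> \<rho>" "s' \<in> \<rho>" by blast
    then have "y + z = (r + r') - (s + s')" "r + r' \<in> \<rho>" "s + s' \<in> \<rho>"
      using convex_cone_add[OF assms(1)] by auto
    then show "y + z \<in> ?D" by blast
  next
    fix c y assume "y \<in> ?D"
    then obtain r s where y: "y = r - s" "r \<in> \<rho>" "s \<in> \<rho>" by blast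
    show "c *\<^sub>R y \<in> ?D"
    proof (cases "c \<ge> 0")
      case True
      have "c *\<^sub>R y = c *\<^sub>R r - c *\<^sub>R s" using y(1) by (simp add: scaleR_diff_right)
      then show ?thesis using y convex_cone_scaleR[OF assms(1) True] by blast
    next
      case False
      have "c *\<^sub>R y = (-c) *\<^sub>R s - (-c) *\<^sub>R r" using y(1) by (simp add: scaleR_diff_right)
      moreover have "(-c) *\<^sub>R s \<in> \<rho>" "(-c) *\<^sub>R r \<in> \<rho>"
        using False y convex_cone_scaleR[OF assms(1), of "-c"] by simp_all
      ultimately show ?thesis by blast
    qed
  qed
  moreover have "\<rho> \<subseteq> ?D" using convex_cone_contains_0[OF assms(1)] by force
  ultimately have "v \<in> ?D" using assms(2) span_minimal by blast
  then show ?thesis using that by blast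
qed

section \<open>Polyhedrality of the cone over a polyhedral cone\<close>

lemma polyhedron_linear_preimage:
  fixes g :: "'a::euclidean_space \<Rightarrow> 'b::euclidean_space"
  assumes g: "linear g" and S: "polyhedron S"
  shows "polyhedron (g -` S)"
proof -
  obtain F where F: "finite F" "S = \<Inter>F" "\<forall>h\<in>F. \<exists>a b. a \<noteq> 0 \<and> h = {x. a \<bullet> x \<le> b}"
    using S unfolding polyhedron_def by blast
  have "polyhedron (g -` h)" if h: "h \<in> F" for h
  proof -
    obtain a b where "h = {x. a \<bullet> x \<le> b}" using F h by blast
    then have "g -` h = {x. adjoint g a \<bullet> x \<le> b}"
      using adjoint_works[OF g] by (auto simp: inner_commute)
    then show ?thesis by (simp add: polyhedron_halfspace_le)
  qed
  then have "polyhedron (\<Inter>h\<in>F. g -` h)" using F by (intro polyhedron_Inter) auto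
  moreover have "(\<Inter>h\<in>F. g -` h) = g -` S" using F by auto
  ultimately show ?thesis by simp
qed

text \<open>As \<open>x\<close> lies off the span, its coefficient is a linear function:
  \<open>f\<close> is 1 at \<open>x\<close> and 0 on \<rho>, with \<open>n\<close> the component of
  \<open>x\<close> orthogonal to the span. The cone is cut out by nonnegativity of this coefficient
  and by the condition that the projection \<open>g\<close> along \<open>x\<close> lands in
  \<rho>.\<close>

lemma polyhedron_join_ray:
  fixes \<rho> :: "'a::euclidean_space set"
  assumes cc: "convex_cone \<rho>" and ph: "polyhedron \<rho>" and x: "x \<notin> span \<rho>"
  shows "polyhedron (convex_cone hull (insert x \<rho>))"
proof -
  obtain s n where sn: "s \<in> span \<rho>" "\<And>w. w \<in> span \<rho> \<Longrightarrow> orthogonal n w" "x = s + n"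
    using orthogonal_subspace_decomp_exists[of \<rho> x] by metis
  have n0: "n \<noteq> 0" using sn x by auto
  define f where "f y = (n \<bullet> y) / (n \<bullet> n)" for y
  have f\<rho>: "f r = 0" if "r \<in> \<rho>" for r
    using sn(2)[OF span_base[OF that]] by (simp add: f_def orthogonal_def)
  have fx: "f x = 1" using sn n0 by (simp add: f_def inner_right_distrib orthogonal_def)
  have f_lin: "f (a *\<^sub>R y + z) = a * f y + f z" for a y z
    by (simp add: f_def inner_right_distrib add_divide_distrib)
  define g where "g y = y - f y *\<^sub>R x" for y
  have "linear g"
    by (rule linearI) (simp_all add: g_def f_def inner_right_distrib algebra_simps add_divide_distrib)
  have "convex_cone hull (insert x \<rho>) = {y. n \<bullet> y \<ge> 0} \<inter> g -` \<rho>"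
  proof (intro equalityI subsetI)
    fix y assume "y \<in> convex_cone hull (insert x \<rho>)"
    then obtain a r where y: "y = a *\<^sub>R x + r" "a \<ge> 0" "r \<in> \<rho>"
      unfolding convex_cone_hull_insert[OF cc] by blast
    have fy: "f y = a" using y f\<rho> fx f_lin by simp
    then have "n \<bullet> y = a * (n \<bullet> n)" using n0 by (auto simp: f_def field_simps)
    then show "y \<in> {y. n \<bullet> y \<ge> 0} \<inter> g -` \<rho>" using y fy by (simp add: g_def)
  next
    fix y assume y: "y \<in> {y. n \<bullet> y \<ge> 0} \<inter> g -` \<rho>"
    then have "f y \<ge> 0" by (simp add: f_def)
    moreover have "y = f y *\<^sub>R x + g y" by (simp add: g_def)
    ultimately show "y \<in> convex_cone hull (insert x \<rho>)"
      using y unfolding convex_cone_hull_insert[OF cc] by blast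
  qed
  then show ?thesis
    using polyhedron_linear_preimage[OF \<open>linear g\<close> ph] polyhedron_halfspace_ge[of 0 n]
    by (simp add: polyhedron_Int)
qed

section \<open>Direct sums of cones\<close>

text \<open>The summands serve as their own indices, so no cone occurs twice. Families are total
  functions and hence are compared on \<open>A\<close> only; the empty sum is
  \<open>{0}\<close>.\<close>

definition direct_sum :: "'a::real_vector set set \<Rightarrow> 'a set \<Rightarrow> bool" where
  "direct_sum A z \<longleftrightarrow>
     finite A \<and> z = {\<Sum>a\<in>A. v a | v. \<forall>a\<in>A. v a \<in> a} \<and>
     (\<forall>u v. (\<forall>a\<in>A. u a \<in> a \<and> v a \<in> a) \<and> sum u A = sum v A \<longrightarrow> (\<forall>a\<in>A. u a = v a))"

lemma direct_sum_ex:
  assumes "direct_sum A z" "y \<in> z"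
  obtains v where "\<And>a. a \<in> A \<Longrightarrow> v a \<in> a" "y = (\<Sum>a\<in>A. v a)"
  using assms unfolding direct_sum_def by blast

lemma direct_sum_unique:
  assumes "direct_sum A z" "\<And>a. a \<in> A \<Longrightarrow> u a \<in> a" "\<And>a. a \<in> A \<Longrightarrow> v a \<in> a"
    "sum u A = sum v A" "a \<in> A"
  shows "u a = v a"
  using assms unfolding direct_sum_def by blast

lemma direct_sum_empty_iff: "direct_sum {} z \<longleftrightarrow> z = {0}"
  unfolding direct_sum_def by auto

lemma direct_sum_subset:
  assumes "direct_sum A z" "convex_cone K" "\<And>a. a \<in> A \<Longrightarrow> a \<subseteq> K"
  shows "z \<subseteq> K"
proof
  fix y assume "y \<in> z"
  then obtain v where "\<And>a. a \<in> A \<Longrightarrow> v a \<in> a" "y = (\<Sum>a\<in>A. v a)"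
    using direct_sum_ex[OF assms(1)] by blast
  then show "y \<in> K" using convex_cone_sum[OF assms(2), of A v] assms(3) by (simp add: subset_iff)
qed

lemma sums_convex_cone:
  assumes "\<And>a. a \<in> A \<Longrightarrow> convex_cone (Q a)"
  shows "convex_cone {\<Sum>a\<in>A. v a | v. \<forall>a\<in>A. v a \<in> Q a}" (is "convex_cone ?S")
proof (rule convex_coneI)
  show "0 \<in> ?S" using assms convex_cone_contains_0 by (force intro: exI[of _ "\<lambda>_. 0"])
  fix x y assume "x \<in> ?S" "y \<in> ?S"
  then obtain u v where "x = sum u A" "y = sum v A" "\<forall>a\<in>A. u a \<in> Q a" "\<forall>a\<in>A. v a \<in> Q a" by blast
  then have "x + y = (\<Sum>a\<in>A. u a + v a)" "\<forall>a\<in>A. u a + v a \<in> Q a"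
    using convex_cone_add[OF assms] by (simp_all add: sum.distrib)
  then show "x + y \<in> ?S" by blast
next
  fix x and c :: real assume "x \<in> ?S" "c \<ge> 0"
  then obtain u where "x = sum u A" "\<forall>a\<in>A. u a \<in> Q a" by blast
  then have "c *\<^sub>R x = (\<Sum>a\<in>A. c *\<^sub>R u a)" "\<forall>a\<in>A. c *\<^sub>R u a \<in> Q a"
    using convex_cone_scaleR[OF assms] \<open>c \<ge> 0\<close> by (simp_all add: scaleR_sum_right)
  then show "c *\<^sub>R x \<in> ?S" by blast
qed

text \<open>By uniqueness, the components of \<open>b + c\<close> are the sums of the components of
  \<open>b\<close> and \<open>c\<close>, so absorption can be checked in each summand. Uniqueness
  also recovers \<open>Q a\<close> as the trace of the face on \<open>a\<close>.\<close>

lemma direct_sum_faces: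
  fixes z :: "'a::euclidean_space set"
  assumes z: "direct_sum A z" and A: "\<And>a. a \<in> A \<Longrightarrow> convex_cone a"
    and Q: "\<And>a. a \<in> A \<Longrightarrow> Q a face_of a" "\<And>a. a \<in> A \<Longrightarrow> Q a \<noteq> {}"
  obtains F where "F face_of z" "F \<noteq> {}" "\<And>a. a \<in> A \<Longrightarrow> F \<inter> a = Q a"
proof -
  define F where "F = {\<Sum>a\<in>A. v a | v. \<forall>a\<in>A. v a \<in> Q a}"
  note fin = z[unfolded direct_sum_def, THEN conjunct1]
  note Q' = face_of_coneD[OF Q A]
  have F: "convex_cone F" unfolding F_def by (intro sums_convex_cone Q'(1))
  have z_eq: "z = {\<Sum>a\<in>A. v a | v. \<forall>a\<in>A. v a \<in> a}" using z unfolding direct_sum_def by blast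
  have zc: "convex_cone z" unfolding z_eq using sums_convex_cone[of A "\<lambda>a. a"] A by simp
  have "F \<subseteq> z" using Q'(2) unfolding F_def z_eq by blast
  moreover have "b \<in> F" if b: "b \<in> z" "c \<in> z" "b + c \<in> F" for b c
  proof -
    obtain u where u: "\<And>a. a \<in> A \<Longrightarrow> u a \<in> a" "b = sum u A" using direct_sum_ex[OF z b(1)] by blast
    obtain w where w: "\<And>a. a \<in> A \<Longrightarrow> w a \<in> a" "c = sum w A" using direct_sum_ex[OF z b(2)] by blast
    obtain v where v: "\<And>a. a \<in> A \<Longrightarrow> v a \<in> Q a" "b + c = sum v A" using b(3) unfolding F_def by blast
    have "v a = u a + w a" if "a \<in> A" for a
      by (rule direct_sum_unique[OF z _ _ _ that])
        (use u w v(2) subsetD[OF Q'(2) v(1)] convex_cone_add[OF A] in \<open>auto simp: sum.distrib\<close>)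
    then have "u a \<in> Q a" if "a \<in> A" for a using Q'(3)[OF that that that u(1) w(1)] v(1) that by metis
    then show ?thesis unfolding F_def u(2) by blast
  qed
  ultimately have "F face_of z"
    using F convex_cone_nonempty[OF F] by (subst face_of_cone_iff[OF zc]) auto
  moreover have "F \<inter> a = Q a" if a: "a \<in> A" for a
  proof (intro equalityI subsetI)
    have single: "(\<Sum>b\<in>A. if b = a then y else 0) = y" for y :: 'a using a fin by simp
    fix y
    {
      assume "y \<in> F \<inter> a"
      then obtain v where v: "\<And>a. a \<in> A \<Longrightarrow> v a \<in> Q a" "y = sum v A" "y \<in> a" unfolding F_def by blast
      have "v a = (if a = a then y else 0)"
        by (rule direct_sum_unique[OF z, of v "\<lambda>b. if b = a then y else 0"])
          (use v a single subsetD[OF Q'(2) v(1)] convex_cone_contains_0[OF A] in auto)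
      then show "y \<in> Q a" using v(1)[OF a] by simp
    }
    assume y: "y \<in> Q a"
    have "\<forall>b\<in>A. (if b = a then y else 0) \<in> Q b" using y convex_cone_contains_0[OF Q'(1)] by auto
    then have "y \<in> F" unfolding F_def using single[of y]
      by (intro CollectI exI[of _ "\<lambda>b. if b = a then y else 0"]) simp
    then show "y \<in> F \<inter> a" using subsetD[OF Q'(2)[OF a a a] y] by blast
  qed
  ultimately show ?thesis using that convex_cone_nonempty[OF F] by blast
qed

lemma direct_sum_summand:
  assumes "direct_sum A z" "\<And>a. a \<in> A \<Longrightarrow> convex_cone a" "a \<in> A"
  shows "a \<subseteq> z"
proof
  fix y assume y: "y \<in> a"
  have "(\<Sum>b\<in>A. if b = a then y else 0) = y"
    using assms(1,3) unfolding direct_sum_def by simp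
  moreover have "\<forall>b\<in>A. (if b = a then y else 0) \<in> b"
    using y convex_cone_contains_0[OF assms(2)] by auto
  moreover have "z = {\<Sum>a\<in>A. v a | v. \<forall>a\<in>A. v a \<in> a}"
    using assms(1) unfolding direct_sum_def by blast
  ultimately show "y \<in> z" by (auto intro!: exI[of _ "\<lambda>b. if b = a then y else 0"])
qed

section \<open>Factors and antichains\<close>

definition antichain :: "'a::order set \<Rightarrow> bool" where
  "antichain A \<longleftrightarrow> (\<forall>a\<in>A. \<forall>b\<in>A. a \<le> b \<longrightarrow> a = b)"

lemma antichain_subset: "antichain A \<Longrightarrow> B \<subseteq> A \<Longrightarrow> antichain B"
  unfolding antichain_def by blast

lemma antichain_factors: "antichain (factors G z)"
  unfolding antichain_def factors_def by (auto simp: order_le_less)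

lemma factors_subset: "factors G z \<subseteq> G"
  unfolding factors_def by blast

lemma factors_le: "y \<in> factors G z \<Longrightarrow> y \<le> z"
  unfolding factors_def by blast

lemma factors_above:
  assumes "finite G" "g \<in> G" "g \<le> z"
  obtains f where "f \<in> factors G z" "g \<le> f"
proof -
  have "\<exists>m\<in>{y \<in> G. y \<le> z}. g \<le> m \<and> (\<forall>b\<in>{y \<in> G. y \<le> z}. m \<le> b \<longrightarrow> m = b)"
    using finite_has_maximal2[of "{y \<in> G. y \<le> z}" g] assms by auto
  then show ?thesis using that unfolding factors_def by (auto simp: less_le)
qed

text \<open>This is how factors are computed below: an antichain that is cofinal among the elements
  of \<open>G\<close> under \<open>z\<close> consists of the maximal ones.\<close>

lemma factors_eqI:
  assumes "B \<subseteq> G" "antichain B" "\<And>b. b \<in> B \<Longrightarrow> b \<le> z" "\<And>g. g \<in> G \<Longrightarrow> g \<le> z \<Longrightarrow> \<exists>b\<in>B. g \<le> b"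
  shows "factors G z = B"
proof (intro equalityI subsetI)
  fix f assume f: "f \<in> factors G z"
  then obtain b where b: "b \<in> B" "f \<le> b" using assms(4) unfolding factors_def by blast
  then have "f = b" using f assms(1,3) unfolding factors_def by (auto simp: order_le_less)
  then show "f \<in> B" using b by simp
next
  fix b assume b: "b \<in> B"
  have "\<not> b < g" if g: "g \<in> G" "g \<le> z" for g
  proof
    assume "b < g"
    obtain b' where "b' \<in> B" "g \<le> b'" using assms(4) g by blast
    then show False using \<open>b < g\<close> b assms(2) unfolding antichain_def
      by (metis order_less_le_trans order_less_imp_le order_less_irrefl)
  qed
  then show "b \<in> factors G z" using b assms(1,3) unfolding factors_def by blast
qed

lemma factors_member:
  assumes "g \<in> G"
  shows "factors G g = {g}"
  using assms by (intro factors_eqI) (auto simp: antichain_def)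

section \<open>Fans\<close>

context
  fixes \<Sigma> :: "'a::euclidean_space set set"
  assumes fan: "polyhedral_fan \<Sigma>"
begin

lemma fan_finite: "finite \<Sigma>"
  using fan unfolding polyhedral_fan_def by blast

lemma fan_pointed: "\<sigma> \<in> \<Sigma> \<Longrightarrow> pointed_polyhedral_cone \<sigma>"
  using fan unfolding polyhedral_fan_def by blast

lemma fan_convex_cone: "\<sigma> \<in> \<Sigma> \<Longrightarrow> convex_cone \<sigma>"
  using fan_pointed pointed_coneD(1) by blast

lemma fan_0: "\<sigma> \<in> \<Sigma> \<Longrightarrow> 0 \<in> \<sigma>"
  using fan_convex_cone convex_cone_contains_0 by blast

lemma fan_face: "\<sigma> \<in> \<Sigma> \<Longrightarrow> F face_of \<sigma> \<Longrightarrow> F \<noteq> {} \<Longrightarrow> F \<in> \<Sigma>"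
  using fan unfolding polyhedral_fan_def by blast

lemma fan_Int_face: "\<sigma> \<in> \<Sigma> \<Longrightarrow> \<tau> \<in> \<Sigma> \<Longrightarrow> \<sigma> \<inter> \<tau> face_of \<sigma>"
  using fan unfolding polyhedral_fan_def by blast

lemma fan_Int: "\<sigma> \<in> \<Sigma> \<Longrightarrow> \<tau> \<in> \<Sigma> \<Longrightarrow> \<sigma> \<inter> \<tau> \<in> \<Sigma>"
  using fan_face[OF _ fan_Int_face] fan_0 by blast

lemma fan_subset_face: "\<sigma> \<in> \<Sigma> \<Longrightarrow> \<tau> \<in> \<Sigma> \<Longrightarrow> \<sigma> \<subseteq> \<tau> \<Longrightarrow> \<sigma> face_of \<tau>"
  using fan_Int_face[of \<tau> \<sigma>] by (simp add: Int_absorb1)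

text \<open>\<sigma> \<inter> \<tau> is a face of \<sigma>, so it absorbs summands taken from
  \<sigma>, even though \<tau> need not lie in \<sigma>.\<close>

lemma fan_absorb:
  assumes "\<sigma> \<in> \<Sigma>" "\<tau> \<in> \<Sigma>" "a \<in> \<sigma>" "b \<in> \<sigma>" "a + b \<in> \<tau>"
  shows "a \<in> \<tau>" "b \<in> \<tau>"
proof -
  have "\<sigma> \<inter> \<tau> \<noteq> {}" using fan_0 assms by blast
  moreover have "a + b \<in> \<sigma> \<inter> \<tau>" using assms convex_cone_add[OF fan_convex_cone[OF assms(1)]] by blast
  ultimately have "a \<in> \<sigma> \<inter> \<tau>" "b \<in> \<sigma> \<inter> \<tau>"
    using face_of_coneD(3,4)[OF fan_Int_face[OF assms(1,2)] _ fan_convex_cone[OF assms(1)] assms(3,4)] by blast+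
  then show "a \<in> \<tau>" "b \<in> \<tau>" by blast+
qed

lemma fan_rel_interior:
  assumes "\<sigma> \<in> \<Sigma>" "\<tau> \<in> \<Sigma>" "x \<in> rel_interior \<tau>" "x \<in> \<sigma>"
  shows "\<tau> \<subseteq> \<sigma>"
proof -
  have "\<tau> \<inter> \<sigma> face_of \<tau>" using fan_Int_face assms by blast
  moreover have "x \<in> \<tau> \<inter> \<sigma>" using assms rel_interior_subset by blast
  ultimately have "\<tau> \<subseteq> \<tau> \<inter> \<sigma>" using assms(3) subset_of_face_of[of "\<tau> \<inter> \<sigma>" \<tau> \<tau>] by blast
  then show ?thesis by blast
qed

lemma fan_rel_interior_nonzero:
  assumes "\<tau> \<in> \<Sigma>" "\<tau> \<noteq> {0}" "x \<in> rel_interior \<tau>"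
  shows "x \<noteq> 0"
  using fan_rel_interior[OF zero_in_polyhedral_fan[OF fan] assms(1,3)] assms(2) fan_0[OF assms(1)] by blast

lemma fan_push:
  assumes "\<sigma> \<in> \<Sigma>" "x \<in> \<sigma>" "x \<noteq> 0" "y \<in> \<sigma>"
  obtains a \<rho> where "a \<ge> 0" "\<rho> \<in> \<Sigma>" "\<rho> \<subseteq> \<sigma>" "y - a *\<^sub>R x \<in> \<rho>" "x \<notin> \<rho>"
proof -
  obtain a F where F: "a \<ge> 0" "F face_of \<sigma>" "y - a *\<^sub>R x \<in> F" "x \<notin> F"
    using push_to_face[OF fan_pointed[OF assms(1)] assms(2,3,4)] by blast
  then have "F \<in> \<Sigma>" "F \<subseteq> \<sigma>" using fan_face[OF assms(1)] face_of_imp_subset by blast+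
  then show ?thesis using that F by blast
qed

end

text \<open>The condition covers the cone \<open>{0}\<close> as well: it has no factors and is the
  empty sum.\<close>

definition geometric_building_set :: "'a::euclidean_space set set \<Rightarrow> 'a set set \<Rightarrow> bool" where
  "geometric_building_set \<Sigma> G \<longleftrightarrow>
     polyhedral_fan \<Sigma> \<and> G \<subseteq> \<Sigma> - {{0}} \<and> (\<forall>\<sigma>\<in>\<Sigma>. direct_sum (factors G \<sigma>) \<sigma>)"

text \<open>Two representations of the same point have the same minimal faces in every summand, since a
  face of a summand \<open>a\<close> extends to a face of \<open>\<sigma>\<close> that contains all other summands. Let \<open>c\<close> be minimal
  such that \<open>c *\<^sub>R u - v\<close> lies in all summands. If \<open>c > 1\<close>, rescaling \<open>c *\<^sub>R u - v\<close> gives another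
  representation, on the boundary of the minimal face of \<open>u\<close>, which contradicts the equality of
  the minimal faces; so \<open>c = 1\<close>, and \<open>u - v\<close> vanishes because \<open>\<sigma>\<close> is pointed.\<close>

lemma unique_sum_of_faces:
  fixes \<sigma> :: "'a::euclidean_space set"
  assumes fin: "finite A" and \<sigma>: "pointed_polyhedral_cone \<sigma>"
    and A: "\<And>a. a \<in> A \<Longrightarrow> pointed_polyhedral_cone a" "\<And>a. a \<in> A \<Longrightarrow> a \<subseteq> \<sigma>"
    and faces: "\<And>a F. a \<in> A \<Longrightarrow> F face_of a \<Longrightarrow> F \<noteq> {} \<Longrightarrow>
        \<exists>\<Phi>. \<Phi> face_of \<sigma> \<and> \<Phi> \<inter> a = F \<and> (\<forall>b\<in>A - {a}. b \<subseteq> \<Phi>)"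
    and u: "\<And>a. a \<in> A \<Longrightarrow> u a \<in> a" and v: "\<And>a. a \<in> A \<Longrightarrow> v a \<in> a"
    and uv: "sum u A = sum v A" and "a \<in> A"
  shows "u a = v a"
proof -
  note \<sigma>' = pointed_coneD[OF \<sigma>]
  have Ac: "convex_cone a" "closed a" if "a \<in> A" for a using pointed_coneD[OF A(1)[OF that]] by auto
  have same: "r a \<in> min_face a (s a)"
    if a: "a \<in> A" and rs: "\<And>a. a \<in> A \<Longrightarrow> r a \<in> a" "\<And>a. a \<in> A \<Longrightarrow> s a \<in> a" "sum r A = sum s A" for r s a
  proof -
    note mf = min_face[OF Ac(1)[OF a] rs(2)[OF a]]
    obtain \<Phi> where \<Phi>: "\<Phi> face_of \<sigma>" "\<Phi> \<inter> a = min_face a (s a)" "\<forall>b\<in>A - {a}. b \<subseteq> \<Phi>"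
      using faces[OF a mf(1)] mf(2) by blast
    have \<Phi>': "\<Phi> \<noteq> {}" using \<Phi>(2) mf(2) by blast
    note \<Phi>c = face_of_coneD[OF \<Phi>(1) \<Phi>' \<sigma>'(1)]
    have "s b \<in> \<Phi>" if b: "b \<in> A" for b
    proof (cases "b = a")
      case True
      then show ?thesis using \<Phi>(2) mf(2) by blast
    next
      case False
      then show ?thesis using \<Phi>(3) rs(2)[OF b] b by blast
    qed
    then have "sum s A \<in> \<Phi>" by (intro convex_cone_sum \<Phi>c(1))
    then have "r a + sum r (A - {a}) \<in> \<Phi>" using rs(3) sum.remove[OF fin a, of r] by simp
    moreover have "r a \<in> \<sigma>" "sum r (A - {a}) \<in> \<sigma>" using a rs(1) A(2) by (auto intro!: convex_cone_sum \<sigma>')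
    ultimately have "r a \<in> \<Phi>" using \<Phi>c(3) by blast
    then show ?thesis using \<Phi>(2) rs(1) a by blast
  qed
  have zero: "w a = 0" if w: "\<And>a. a \<in> A \<Longrightarrow> w a \<in> a" "sum w A = 0" "a \<in> A" for w a
  proof -
    have "w a + sum w (A - {a}) = 0" using w sum.remove[OF fin w(3), of w] by simp
    then have "- w a = sum w (A - {a})" by (metis add.inverse_unique)
    moreover have "sum w (A - {a}) \<in> \<sigma>" "w a \<in> \<sigma>" using w(1,3) A(2) by (auto intro!: convex_cone_sum \<sigma>')
    ultimately show ?thesis using \<sigma>'(4) by metis
  qed
  show ?thesis
  proof (cases "sum u A = 0")
    case True
    then have "u a = 0" "v a = 0" using zero[OF u _ \<open>a \<in> A\<close>] zero[OF v _ \<open>a \<in> A\<close>] uv by simp_all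
    then show ?thesis by simp
  next
    case False
    define T where "T = (\<Inter>a\<in>A. (\<lambda>c. c *\<^sub>R u a - v a) -` a)"
    have clT: "closed T" unfolding T_def
      by (intro closed_INT ballI continuous_closed_vimage Ac continuous_intros)
    have bound1: "\<exists>c>0. \<forall>d\<ge>c. d *\<^sub>R s a - r a \<in> a"
      if a: "a \<in> A" and rs: "\<And>a. a \<in> A \<Longrightarrow> r a \<in> a" "\<And>a. a \<in> A \<Longrightarrow> s a \<in> a" "sum r A = sum s A" for r s a
      using min_face_scale_bound[OF Ac(1)[OF a] rs(2)[OF a] same[OF that]] by blast
    have bound: "\<exists>d>0. \<forall>a\<in>A. d *\<^sub>R s a - r a \<in> a"
      if rs: "\<And>a. a \<in> A \<Longrightarrow> r a \<in> a" "\<And>a. a \<in> A \<Longrightarrow> s a \<in> a" "sum r A = sum s A" for r s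
    proof -
      obtain f where f: "\<And>a. a \<in> A \<Longrightarrow> f a > (0::real)" "\<And>a d. a \<in> A \<Longrightarrow> d \<ge> f a \<Longrightarrow> d *\<^sub>R s a - r a \<in> a"
        using bound1[OF _ rs] by metis
      \<comment> \<open>One more than the sum of the thresholds exceeds each of them, and is
        positive even for empty \<open>A\<close>.\<close>
      have "f a \<le> 1 + sum f A" if "a \<in> A" for a
      proof -
        have "f a \<le> sum f A" using f(1) fin that by (intro member_le_sum) (auto simp: less_imp_le)
        then show ?thesis by simp
      qed
      moreover have "1 + sum f A > 0" using f(1) by (smt (verit) sum_nonneg)
      ultimately show ?thesis using f(2) by blast
    qed
    have sumT: "(c - 1) *\<^sub>R sum u A \<in> \<sigma>" if "c \<in> T" for c
    proof -
      have "(\<Sum>a\<in>A. c *\<^sub>R u a - v a) \<in> \<sigma>" using that A(2) by (intro convex_cone_sum \<sigma>') (auto simp: T_def)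
      moreover have "(\<Sum>a\<in>A. c *\<^sub>R u a - v a) = (c - 1) *\<^sub>R sum u A"
        using uv by (simp add: sum_subtractf scaleR_sum_right[symmetric] scaleR_diff_left)
      ultimately show ?thesis by simp
    qed
    have u\<sigma>: "sum u A \<in> \<sigma>" using u A(2) by (intro convex_cone_sum \<sigma>') auto
    \<comment> \<open>For \<open>c < 1\<close>, adding the memberships over \<open>A\<close> would
      put a negative multiple of the nonzero common sum into \<sigma>, against pointedness.\<close>
    have ge1: "c \<ge> 1" if "c \<in> T" for c
    proof (rule ccontr)
      assume "\<not> c \<ge> 1"
      then have "(1 / (1 - c)) *\<^sub>R ((c - 1) *\<^sub>R sum u A) \<in> \<sigma>"
        by (intro convex_cone_scaleR[OF \<sigma>'(1) _ sumT[OF that]]) auto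
      moreover have "(1 / (1 - c)) * (c - 1) = - 1" using \<open>\<not> c \<ge> 1\<close> by (simp add: field_simps)
      ultimately have "- sum u A \<in> \<sigma>" unfolding scaleR_scaleR by simp
      then show False using \<sigma>'(4) u\<sigma> False by blast
    qed
    obtain d where "\<forall>a\<in>A. d *\<^sub>R u a - v a \<in> a" using bound[OF v u uv[symmetric]] by blast
    then have "T \<noteq> {}" unfolding T_def by blast
    moreover have bdd: "bdd_below T" using ge1 by (auto simp: bdd_below_def)
    ultimately have c: "Inf T \<in> T" using closed_contains_Inf clT by blast
    define c where "c = Inf T"
    have c: "c \<in> T" "c \<ge> 1" using c ge1 by (auto simp: c_def)
    have "c = 1"
    proof (rule ccontr)
      assume "c \<noteq> 1"
      then have c1: "c > 1" using c by simp
      \<comment> \<open>The factor \<open>1 / (c - 1)\<close> gives \<open>s\<close> the same sum as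
        \<open>u\<close>, so \<open>bound\<close> applies to this pair.\<close>
      define s where "s a = (1 / (c - 1)) *\<^sub>R (c *\<^sub>R u a - v a)" for a
      have s: "s a \<in> a" if "a \<in> A" for a unfolding s_def
        using c1 c(1) that by (intro convex_cone_scaleR Ac) (auto simp: T_def)
      have "sum s A = (1 / (c - 1)) *\<^sub>R (c *\<^sub>R sum u A - sum v A)"
        unfolding s_def by (simp add: scaleR_sum_right[symmetric] sum_subtractf)
      also have "\<dots> = (1 / (c - 1)) *\<^sub>R ((c - 1) *\<^sub>R sum u A)" using uv by (simp add: scaleR_diff_left)
      also have "\<dots> = sum u A" using c1 by simp
      finally obtain e where e: "e > 0" "\<forall>a\<in>A. e *\<^sub>R s a - u a \<in> a"
        using bound[of u s] s u by auto
      \<comment> \<open>Written in terms of \<open>u\<close> and \<open>v\<close>, the bound by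
        \<open>e\<close> lowers \<open>c\<close> by the positive amount
        \<open>(c - 1) / e\<close>.\<close>
      have "(c - (c - 1) / e) *\<^sub>R u a - v a \<in> a" if "a \<in> A" for a
      proof -
        have "((c - 1) / e) *\<^sub>R (e *\<^sub>R s a - u a) \<in> a"
          using e c1 that by (intro convex_cone_scaleR Ac) auto
        moreover have "((c - 1) / e) *\<^sub>R (e *\<^sub>R s a - u a) = (c - (c - 1) / e) *\<^sub>R u a - v a"
          using c1 e by (simp add: s_def scaleR_diff_left scaleR_diff_right)
        ultimately show ?thesis by simp
      qed
      then have "c - (c - 1) / e \<in> T" by (simp add: T_def)
      then have "c \<le> c - (c - 1) / e" unfolding c_def using bdd by (simp add: cInf_lower)
      then show False using c1 e by (simp add: field_simps)
    qed
    then have "u a - v a \<in> a" if "a \<in> A" for a using c that by (auto simp: T_def)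
    moreover have "(\<Sum>a\<in>A. u a - v a) = 0" using uv by (simp add: sum_subtractf)
    ultimately have "u a - v a = 0" using zero[of "\<lambda>a. u a - v a", OF _ _ \<open>a \<in> A\<close>] by blast
    then show ?thesis by simp
  qed
qed

text \<open>The isomorphism yields, for each face of a factor, the face of \<open>\<sigma>\<close> required by
  \<open>unique_sum_of_faces\<close>, and a nonzero point of some factor in every nonzero face. Subtracting
  multiples of such points moves any point of \<open>\<sigma>\<close> to smaller and smaller faces, so \<open>\<sigma>\<close> is the sum
  of its factors.\<close>

lemma building_set_direct_sum:
  fixes \<Sigma> :: "'a::euclidean_space set set"
  assumes fan: "polyhedral_fan \<Sigma>" and bs: "building_set \<Sigma> G" and \<sigma>: "\<sigma> \<in> \<Sigma>" "\<sigma> \<noteq> {0}"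
  shows "direct_sum (factors G \<sigma>) \<sigma>"
proof -
  define A where "A = factors G \<sigma>"
  have G: "G \<subseteq> \<Sigma> - {{0}}" using bs bottom_polyhedral_fan[OF fan] unfolding building_set_def by auto
  have A: "a \<in> \<Sigma>" "a \<subseteq> \<sigma>" if "a \<in> A" for a using that G unfolding A_def factors_def by auto
  have finA: "finite A" using A(1) fan_finite[OF fan] by (meson finite_subset subsetI)
  note Z = zero_in_polyhedral_fan[OF fan]
  note O = fan_0[OF fan]
  have bot: "bottom \<Sigma> = {0}" using bottom_polyhedral_fan[OF fan] .
  let ?P = "\<Pi>\<^sub>E y\<in>A. lower_interval \<Sigma> y"
  have "\<exists>\<phi>. order_iso \<phi> ?P (lower_interval \<Sigma> \<sigma>) \<and>
      (\<forall>y\<in>A. \<phi> (\<lambda>z\<in>A. if z = y then y else {0}) = y)"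
    using bs \<sigma> unfolding building_set_def A_def bot by simp
  then obtain \<psi> where \<psi>: "order_iso \<psi> ?P (lower_interval \<Sigma> \<sigma>)"
    "\<And>y. y \<in> A \<Longrightarrow> \<psi> (\<lambda>z\<in>A. if z = y then y else {0}) = y"
    by blast
  have bij: "bij_betw \<psi> ?P (lower_interval \<Sigma> \<sigma>)"
    and mono: "\<And>x y. x \<in> ?P \<Longrightarrow> y \<in> ?P \<Longrightarrow> x \<le> y \<longleftrightarrow> \<psi> x \<subseteq> \<psi> y"
    using \<psi>(1) unfolding order_iso_def by auto
  \<comment> \<open>Composition with the restriction admits families that are arbitrary outside
    \<open>A\<close>.\<close>
  define \<phi> where "\<phi> w = \<psi> (restrict w A)" for w
  have P: "restrict w A \<in> ?P" if "\<And>a. a \<in> A \<Longrightarrow> w a \<in> \<Sigma> \<and> w a \<subseteq> a" for w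
    using that by (auto simp: lower_interval_def)
  have \<phi>1: "\<phi> w \<in> \<Sigma> \<and> \<phi> w \<subseteq> \<sigma>" if "\<And>a. a \<in> A \<Longrightarrow> w a \<in> \<Sigma> \<and> w a \<subseteq> a" for w
    using bij_betwE[OF bij] P[of w] that unfolding \<phi>_def lower_interval_def by blast
  have \<phi>2: "\<exists>w. (\<forall>a\<in>A. w a \<in> \<Sigma> \<and> w a \<subseteq> a) \<and> \<phi> w = F" if F: "F \<in> \<Sigma>" "F \<subseteq> \<sigma>" for F
  proof -
    have "F \<in> lower_interval \<Sigma> \<sigma>" using F unfolding lower_interval_def by blast
    then obtain w where w: "w \<in> ?P" "\<psi> w = F" using bij by (metis bij_betw_imp_surj_on imageE)
    then have "restrict w A = w" by (simp add: PiE_restrict)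
    moreover have "\<forall>a\<in>A. w a \<in> \<Sigma> \<and> w a \<subseteq> a" using w(1) by (auto simp: lower_interval_def PiE_iff)
    ultimately show ?thesis using w unfolding \<phi>_def by metis
  qed
  have \<phi>3: "\<phi> w \<subseteq> \<phi> w' \<longleftrightarrow> (\<forall>a\<in>A. w a \<subseteq> w' a)"
    if w: "\<And>a. a \<in> A \<Longrightarrow> w a \<in> \<Sigma> \<and> w a \<subseteq> a" "\<And>a. a \<in> A \<Longrightarrow> w' a \<in> \<Sigma> \<and> w' a \<subseteq> a" for w w'
  proof -
    have "restrict w A \<le> restrict w' A \<longleftrightarrow> (\<forall>a\<in>A. w a \<subseteq> w' a)"
      unfolding le_fun_def by auto
    then show ?thesis
      using mono[OF P P] w unfolding \<phi>_def by blast
  qed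
  \<comment> \<open>\<open>e a\<close> is the tuple sent to the factor \<open>a\<close> itself.
    Comparison with it shows that a cone inside \<open>a\<close> comes from a tuple that is
    \<open>{0}\<close> in every other coordinate.\<close>
  define e where "e a = (\<lambda>b. if b = a then a else {0})" for a :: "'a set"
  have e: "e a b \<in> \<Sigma> \<and> e a b \<subseteq> b" if "a \<in> A" "b \<in> A" for a b
    using that A Z O unfolding e_def by auto
  have \<phi>e: "\<phi> (e a) = a" if "a \<in> A" for a using \<psi>(2)[OF that] unfolding \<phi>_def e_def .

  have faces: "\<exists>\<Phi>. \<Phi> face_of \<sigma> \<and> \<Phi> \<inter> a = F \<and> (\<forall>b\<in>A - {a}. b \<subseteq> \<Phi>)"
    if a: "a \<in> A" and F: "F face_of a" "F \<noteq> {}" for a F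
  proof -
    have F\<Sigma>: "F \<in> \<Sigma>" "F \<subseteq> a" using fan_face[OF fan A(1)[OF a] F] face_of_imp_subset[OF F(1)] by auto
    then obtain w where w: "\<And>a. a \<in> A \<Longrightarrow> w a \<in> \<Sigma> \<and> w a \<subseteq> a" "\<phi> w = F"
      using \<phi>2[of F] A(2)[OF a] by blast
    have we: "w b \<subseteq> e a b" if "b \<in> A" for b
      using \<phi>3[OF w(1) e[OF a]] w(2) \<phi>e[OF a] F\<Sigma>(2) that by auto
    \<comment> \<open>Raising all coordinates but \<open>a\<close> to their maximum gives a face
      containing \<open>F\<close> and the other factors. Its trace on \<open>a\<close> comes from a
      tuple below both \<open>w'\<close> and \<open>e a\<close>, hence below
      \<open>w\<close>.\<close>
    define w' where "w' b = (if b = a then w a else b)" for b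
    have w': "w' b \<in> \<Sigma> \<and> w' b \<subseteq> b" if "b \<in> A" for b using that A w(1) a unfolding w'_def by auto
    define \<Phi> where "\<Phi> = \<phi> w'"
    have \<Phi>: "\<Phi> \<in> \<Sigma>" "\<Phi> \<subseteq> \<sigma>" using \<phi>1[OF w'] unfolding \<Phi>_def by auto
    have "b \<subseteq> \<Phi>" if "b \<in> A - {a}" for b
    proof -
      have "e b c \<subseteq> w' c" if c: "c \<in> A" for c
      proof (cases "c = b")
        case True
        then show ?thesis using \<open>b \<in> A - {a}\<close> unfolding e_def w'_def by auto
      next
        case False
        then show ?thesis using O w'[OF c] unfolding e_def by auto
      qed
      then show ?thesis using \<phi>3[of "e b" w'] e[of b] w' \<phi>e[of b] \<open>b \<in> A - {a}\<close> unfolding \<Phi>_def by auto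
    qed
    moreover have "F \<subseteq> \<Phi>"
      using \<phi>3[OF w(1) w'] w unfolding \<Phi>_def w'_def by auto
    moreover have "\<Phi> \<inter> a \<subseteq> F"
    proof -
      have "\<Phi> \<inter> a \<in> \<Sigma>" "\<Phi> \<inter> a \<subseteq> \<sigma>" using fan_Int[OF fan \<Phi>(1) A(1)[OF a]] \<Phi> by auto
      then obtain v where v: "\<And>a. a \<in> A \<Longrightarrow> v a \<in> \<Sigma> \<and> v a \<subseteq> a" "\<phi> v = \<Phi> \<inter> a"
        using \<phi>2[of "\<Phi> \<inter> a"] by blast
      have "v b \<subseteq> w' b" if "b \<in> A" for b
        using \<phi>3[OF v(1) w'] v(2) that unfolding \<Phi>_def by auto
      moreover have "v b \<subseteq> e a b" if "b \<in> A" for b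
        using \<phi>3[OF v(1) e[OF a]] v(2) \<phi>e[OF a] that by auto
      ultimately have "v b \<subseteq> w b" if b: "b \<in> A" for b
      proof (cases "b = a")
        case True
        then show ?thesis using \<open>\<And>b. b \<in> A \<Longrightarrow> v b \<subseteq> w' b\<close>[OF b] unfolding w'_def by simp
      next
        case False
        then have "v b \<subseteq> {0}" using \<open>\<And>b. b \<in> A \<Longrightarrow> v b \<subseteq> e a b\<close>[OF b] unfolding e_def by simp
        then show ?thesis using O[of "w b"] w(1)[OF b] by blast
      qed
      then show ?thesis using \<phi>3[OF v(1) w(1)] v(2) w(2) by auto
    qed
    ultimately show ?thesis using F\<Sigma> fan_subset_face[OF fan \<Phi>(1) \<sigma>(1) \<Phi>(2)] by blast
  qed

  have ray: "\<exists>x a. a \<in> A \<and> x \<in> F \<and> x \<in> a \<and> x \<noteq> 0"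
    if F: "F \<in> \<Sigma>" "F \<subseteq> \<sigma>" "F \<noteq> {0}" for F
  proof -
    obtain w where w: "\<And>a. a \<in> A \<Longrightarrow> w a \<in> \<Sigma> \<and> w a \<subseteq> a" "\<phi> w = F" using \<phi>2 F by blast
    obtain u where u: "\<And>a. a \<in> A \<Longrightarrow> u a \<in> \<Sigma> \<and> u a \<subseteq> a" "\<phi> u = {0}" using \<phi>2[of "{0}"] Z O \<sigma> by auto
    have "\<not> F \<subseteq> {0}" using F O by blast
    then obtain a where a: "a \<in> A" "\<not> w a \<subseteq> u a" using \<phi>3[OF w(1) u(1)] w(2) u(2) by auto
    \<comment> \<open>Keeping a single coordinate in which \<open>w\<close> exceeds the tuple
      \<open>u\<close> of \<open>{0}\<close> gives a nonzero cone inside both \<open>F\<close> and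
      the factor \<open>a\<close>.\<close>
    define k where "k b = (if b = a then w a else {0})" for b
    have k: "k b \<in> \<Sigma> \<and> k b \<subseteq> b" if "b \<in> A" for b using that w(1) A Z O unfolding k_def by auto
    have "k b \<subseteq> w b" if "b \<in> A" for b using w(1) that O unfolding k_def by auto
    then have "\<phi> k \<subseteq> F" using \<phi>3[OF k w(1)] w(2) by auto
    moreover have "k b \<subseteq> e a b" if "b \<in> A" for b using w(1) that unfolding k_def e_def by auto
    then have "\<phi> k \<subseteq> a" using \<phi>3[OF k e[OF a(1)]] \<phi>e[OF a(1)] by auto
    moreover have "\<not> \<phi> k \<subseteq> {0}" using \<phi>3[OF k u(1)] u(2) a k_def[of a] by auto
    ultimately show ?thesis using a(1) by blast
  qed

  define S where "S = {\<Sum>a\<in>A. v a | v. \<forall>a\<in>A. v a \<in> a}"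
  have Scc: "convex_cone S"
    unfolding S_def using sums_convex_cone[of A "\<lambda>a. a"] fan_convex_cone[OF fan A(1)] by blast
  have aS: "a \<subseteq> S" if "a \<in> A" for a
  proof
    fix y assume y: "y \<in> a"
    have "(\<Sum>b\<in>A. if b = a then y else 0) = y" using finA that by simp
    moreover have "\<forall>b\<in>A. (if b = a then y else 0) \<in> b" using y O A by auto
    ultimately show "y \<in> S" unfolding S_def by (auto intro!: exI[of _ "\<lambda>b. if b = a then y else 0"])
  qed
  \<comment> \<open>Pushing along a nonzero point of \<open>F\<close> that lies in a factor ends in
    a face without that point, which has fewer cones of the fan strictly below it.\<close>
  have "F \<subseteq> S" if "F \<in> \<Sigma>" "F \<subseteq> \<sigma>" for F
    using that
  proof (induction "card {K\<in>\<Sigma>. K \<subset> F}" arbitrary: F rule: less_induct)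
    case less
    show ?case
    proof (cases "F = {0}")
      case True
      then show ?thesis using convex_cone_contains_0[OF Scc] by simp
    next
      case False
      then obtain x a where x: "a \<in> A" "x \<in> F" "x \<in> a" "x \<noteq> 0" using ray less.prems by blast
      show ?thesis
      proof
        fix y assume "y \<in> F"
        then obtain c F' where F': "c \<ge> 0" "F' \<in> \<Sigma>" "F' \<subseteq> F" "y - c *\<^sub>R x \<in> F'" "x \<notin> F'"
          using fan_push[OF fan less.prems(1) x(2,4)] by metis
        then have "{K\<in>\<Sigma>. K \<subset> F'} \<subset> {K\<in>\<Sigma>. K \<subset> F}" using x(2) by blast
        then have "card {K\<in>\<Sigma>. K \<subset> F'} < card {K\<in>\<Sigma>. K \<subset> F}"
          using fan_finite[OF fan] by (intro psubset_card_mono) auto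
        then have "y - c *\<^sub>R x \<in> S" using less.hyps F' less.prems by blast
        moreover have "c *\<^sub>R x \<in> S" using aS[OF x(1)] x(3) convex_cone_scaleR[OF Scc F'(1)] by blast
        ultimately have "(y - c *\<^sub>R x) + c *\<^sub>R x \<in> S" by (rule convex_cone_add[OF Scc])
        then show "y \<in> S" by simp
      qed
    qed
  qed
  then have "\<sigma> \<subseteq> S" using \<sigma> by blast
  moreover have "S \<subseteq> \<sigma>"
  proof
    fix y assume "y \<in> S"
    then obtain v where v: "\<forall>a\<in>A. v a \<in> a" "y = sum v A" unfolding S_def by blast
    have "v a \<in> \<sigma>" if "a \<in> A" for a using v(1) A(2)[OF that] that by blast
    then show "y \<in> \<sigma>" unfolding v(2) by (intro convex_cone_sum[OF fan_convex_cone[OF fan \<sigma>(1)]])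
  qed
  moreover have "u a = v a"
    if "\<forall>a\<in>A. u a \<in> a \<and> v a \<in> a" "sum u A = sum v A" "a \<in> A" for u v a
    by (rule unique_sum_of_faces[OF finA fan_pointed[OF fan \<sigma>(1)] fan_pointed[OF fan A(1)] A(2) faces])
      (use that in auto)
  ultimately show ?thesis using finA unfolding direct_sum_def S_def A_def by blast
qed

lemma building_set_geometric:
  assumes fan: "polyhedral_fan \<Sigma>" and bs: "building_set \<Sigma> G"
  shows "geometric_building_set \<Sigma> G"
proof -
  have G: "G \<subseteq> \<Sigma> - {{0}}" using bs bottom_polyhedral_fan[OF fan] unfolding building_set_def by auto
  have "direct_sum (factors G \<sigma>) \<sigma>" if \<sigma>: "\<sigma> \<in> \<Sigma>" for \<sigma>
  proof (cases "\<sigma> = {0}")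
    case True
    have "g \<notin> G" if "g \<subseteq> {0}" for g using that G fan_0[OF fan] by blast
    then have "factors G {0} = {}" unfolding factors_def by blast
    then show ?thesis using True by (simp add: direct_sum_empty_iff)
  next
    case False
    then show ?thesis using building_set_direct_sum[OF fan bs \<sigma>] by blast
  qed
  then show ?thesis using fan G unfolding geometric_building_set_def by blast
qed

section \<open>Nested sets\<close>

text \<open>Unlike in \<open>nested\<close>, antichains with fewer than two elements are included.
  For a geometric building set they cost nothing: they are the factors of \<open>{0}\<close> or of
  their single member.\<close>

definition factor_nested :: "'a set set \<Rightarrow> 'a set set \<Rightarrow> 'a set set \<Rightarrow> bool" where
  "factor_nested \<Sigma> G N \<longleftrightarrow>
     N \<subseteq> G \<and> (\<forall>A\<subseteq>N. antichain A \<longrightarrow> (\<exists>z\<in>\<Sigma>. factors G z = A))"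

context
  fixes \<Sigma> :: "'a::euclidean_space set set" and G :: "'a set set"
  assumes gb: "geometric_building_set \<Sigma> G"
begin

lemma gb_fan: "polyhedral_fan \<Sigma>"
  and gb_subset: "g \<in> G \<Longrightarrow> g \<in> \<Sigma>" "g \<in> G \<Longrightarrow> g \<noteq> {0}"
  and gb_direct_sum: "\<sigma> \<in> \<Sigma> \<Longrightarrow> direct_sum (factors G \<sigma>) \<sigma>"
  using gb unfolding geometric_building_set_def by blast+

lemma gb_finite: "finite G"
  using gb_subset(1) fan_finite[OF gb_fan] by (meson finite_subset subsetI)

lemma gb_factor: "a \<in> factors G \<sigma> \<Longrightarrow> a \<in> \<Sigma>"
  using gb_subset(1) factors_subset by blast

lemma gb_factors_zero: "factors G {0} = {}"
proof -
  have "g \<notin> G" if "g \<subseteq> {0}" for g using that gb_subset fan_0[OF gb_fan] by blast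
  then show ?thesis unfolding factors_def by blast
qed

lemma gb_subset_convex_cone:
  assumes "\<sigma> \<in> \<Sigma>" "convex_cone K" "\<And>a. a \<in> factors G \<sigma> \<Longrightarrow> a \<subseteq> K"
  shows "\<sigma> \<subseteq> K"
  using direct_sum_subset[OF gb_direct_sum[OF assms(1)] assms(2,3)] .

text \<open>In a direct sum, a face can be chosen independently in each summand. This takes over the
  role of the product isomorphism.\<close>

lemma gb_face_of_factors:
  assumes \<sigma>: "\<sigma> \<in> \<Sigma>" and Q: "\<And>a. a \<in> factors G \<sigma> \<Longrightarrow> Q a \<in> \<Sigma>" "\<And>a. a \<in> factors G \<sigma> \<Longrightarrow> Q a \<subseteq> a"
  obtains F where "F \<in> \<Sigma>" "F \<subseteq> \<sigma>" "\<And>a. a \<in> factors G \<sigma> \<Longrightarrow> F \<inter> a = Q a"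
proof -
  have Qf: "Q a face_of a" "Q a \<noteq> {}" if "a \<in> factors G \<sigma>" for a
    using fan_subset_face[OF gb_fan Q(1) gb_factor Q(2)] that fan_0[OF gb_fan Q(1)] by blast+
  have cc: "convex_cone a" if "a \<in> factors G \<sigma>" for a
    using fan_convex_cone[OF gb_fan gb_factor[OF that]] .
  obtain F where F: "F face_of \<sigma>" "F \<noteq> {}" "\<And>a. a \<in> factors G \<sigma> \<Longrightarrow> F \<inter> a = Q a"
    by (rule direct_sum_faces[OF gb_direct_sum[OF \<sigma>] cc Qf]) (assumption | rule that | blast)+
  have "F \<in> \<Sigma>" "F \<subseteq> \<sigma>" using fan_face[OF gb_fan \<sigma> F(1,2)] face_of_imp_subset[OF F(1)] .
  then show ?thesis using F(3) by (rule that)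
qed

text \<open>A cone is generated by its factors and is therefore their join. With two or more factors
  it is outside \<open>G\<close>, since an element of \<open>G\<close> is its own only
  factor.\<close>

lemma factor_nested_imp_nested:
  assumes "factor_nested \<Sigma> G N"
  shows "nested \<Sigma> G N"
  unfolding nested_def
proof (intro conjI allI impI)
  show "N \<subseteq> G" using assms unfolding factor_nested_def by blast
  fix A assume A: "A \<subseteq> N" "2 \<le> card A \<and> (\<forall>a\<in>A. \<forall>b\<in>A. a \<noteq> b \<longrightarrow> \<not> a \<subseteq> b)"
  then have "antichain A" unfolding antichain_def by blast
  then obtain z where z: "z \<in> \<Sigma>" "factors G z = A" using assms A(1) unfolding factor_nested_def by blast
  have "is_join \<Sigma> A z"
    unfolding is_join_def using z gb_subset_convex_cone[OF z(1)] fan_convex_cone[OF gb_fan] factors_le by blast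
  moreover have "z \<notin> G" using factors_member[of z G] z(2) A(2) by auto
  ultimately show "\<exists>z. is_join \<Sigma> A z \<and> z \<notin> G" by blast
qed

text \<open>Were some factor \<open>f\<close> of the join \<open>z\<close> outside \<open>A\<close>,
  the members of \<open>A\<close> below \<open>f\<close> would lie in a proper face \<open>m\<close>
  of \<open>f\<close>. Shrinking \<open>f\<close> to \<open>m\<close> in the direct sum would give a
  cone that contains all of \<open>A\<close> but not \<open>z\<close>.\<close>

lemma nested_imp_factor_nested:
  assumes N: "nested \<Sigma> G N"
  shows "factor_nested \<Sigma> G N"
  unfolding factor_nested_def
proof (intro conjI allI impI)
  show NG: "N \<subseteq> G" using N unfolding nested_def by blast
  fix A assume A: "A \<subseteq> N" "antichain A"
  have join: "\<exists>m. is_join \<Sigma> B m \<and> m \<notin> G" if "B \<subseteq> A" "card B \<ge> 2" for B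
  proof -
    have "\<forall>a\<in>B. \<forall>b\<in>B. a \<noteq> b \<longrightarrow> \<not> a \<le> b" using that A(2) unfolding antichain_def by blast
    moreover have "B \<subseteq> N" using that A(1) by blast
    ultimately show ?thesis using N that(2) unfolding nested_def by simp
  qed
  have finA: "finite A" using A(1) NG gb_finite by (meson finite_subset)
  consider "A = {}" | a where "A = {a}" | "card A \<ge> 2"
    using finA by (metis One_nat_def Suc_1 card_0_eq card_1_singletonE le_less_Suc_eq less_Suc0 not_less_eq_eq not_less)
  then show "\<exists>z\<in>\<Sigma>. factors G z = A"
  proof cases
    case 1
    then show ?thesis using gb_factors_zero zero_in_polyhedral_fan[OF gb_fan] by blast
  next
    case (2 a)
    then have "a \<in> G" using A(1) NG by blast
    then show ?thesis using factors_member gb_subset(1) 2 by blast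
  next
    case 3
    then obtain z where z: "is_join \<Sigma> A z" using join by blast
    then have z\<Sigma>: "z \<in> \<Sigma>" and Az: "\<And>a. a \<in> A \<Longrightarrow> a \<subseteq> z"
      and least: "\<And>w. w \<in> \<Sigma> \<Longrightarrow> (\<And>a. a \<in> A \<Longrightarrow> a \<subseteq> w) \<Longrightarrow> z \<subseteq> w"
      unfolding is_join_def by blast+
    have "f \<in> A" if f: "f \<in> factors G z" for f
    proof (rule ccontr)
      assume fA: "f \<notin> A"
      have fG: "f \<in> G" "f \<in> \<Sigma>" "f \<subseteq> z" using f gb_factor factors_subset factors_le by blast+
      define B where "B = {a \<in> A. a \<subseteq> f}"
      have finB: "finite B" using finA unfolding B_def by simp
      \<comment> \<open>The proper face is \<open>{0}\<close>, the single member below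
        \<open>f\<close>, or the join of the members below \<open>f\<close>. Nestedness keeps that
        join out of \<open>G\<close> and so distinct from \<open>f\<close>.\<close>
      have "\<exists>m\<in>\<Sigma>. m \<subseteq> f \<and> m \<noteq> f \<and> (\<forall>b\<in>B. b \<subseteq> m)"
      proof -
        consider "B = {}" | a where "B = {a}" | "card B \<ge> 2"
          using finB by (metis One_nat_def Suc_1 card_0_eq card_1_singletonE le_less_Suc_eq less_Suc0 not_less_eq_eq not_less)
        then show ?thesis
        proof cases
          case 1
          then show ?thesis
            using zero_in_polyhedral_fan[OF gb_fan] gb_subset[OF fG(1)] fan_0[OF gb_fan fG(2)]
            by (intro bexI[of _ "{0}"]) auto
        next
          case (2 a)
          then have "a \<in> A" "a \<subseteq> f" unfolding B_def by auto
          then show ?thesis using 2 fA A(1) NG gb_subset(1) by (intro bexI[of _ a]) auto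
        next
          case 3
          then obtain m where m: "is_join \<Sigma> B m" "m \<notin> G" using join[of B] unfolding B_def by blast
          have "m \<subseteq> f" using m(1) fG(2) unfolding is_join_def B_def by blast
          then show ?thesis using m fG unfolding is_join_def by blast
        qed
      qed
      then obtain m where m: "m \<in> \<Sigma>" "m \<subseteq> f" "m \<noteq> f" "\<forall>b\<in>B. b \<subseteq> m" by blast
      obtain F where F: "F \<in> \<Sigma>" "\<And>a. a \<in> factors G z \<Longrightarrow> F \<inter> a = (if a = f then m else a)"
      proof (rule gb_face_of_factors[OF z\<Sigma>])
        fix a assume "a \<in> factors G z"
        then show "(if a = f then m else a) \<in> \<Sigma>" "(if a = f then m else a) \<subseteq> a"
          using m gb_factor by auto
      qed (rule that)
      have "a \<subseteq> F" if a: "a \<in> A" for a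
      proof -
        obtain f' where f': "f' \<in> factors G z" "a \<subseteq> f'"
          using factors_above[OF gb_finite _ Az[OF a]] A(1) NG a by blast
        show ?thesis
        proof (cases "f' = f")
          case True
          then have "a \<in> B" using a f' unfolding B_def by blast
          then show ?thesis using m(4) F(2)[OF f] by auto
        next
          case False
          then show ?thesis using F(2)[OF f'(1)] f'(2) by auto
        qed
      qed
      then have "z \<subseteq> F" using least F(1) by blast
      then show False using F(2)[OF f] fG(3) m by auto
    qed
    moreover have "a \<in> factors G z" if a: "a \<in> A" for a
    proof -
      obtain f where f: "f \<in> factors G z" "a \<subseteq> f"
        using factors_above[OF gb_finite _ Az[OF a]] A(1) NG a by blast
      then have "a = f" using calculation A(2) a unfolding antichain_def by blast
      then show ?thesis using f by simp
    qed
    ultimately have "factors G z = A" by blast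
    then show ?thesis using z\<Sigma> by blast
  qed
qed

lemma nested_iff_factor_nested: "nested \<Sigma> G N \<longleftrightarrow> factor_nested \<Sigma> G N"
  using factor_nested_imp_nested nested_imp_factor_nested by blast

text \<open>Keep the summands in \<open>B\<close> and shrink the others to \<open>{0}\<close>. An
  element of \<open>G\<close> below the result is nonzero, so the factor above it is one of those
  kept.\<close>

lemma subset_factors:
  assumes \<sigma>: "\<sigma> \<in> \<Sigma>" and B: "B \<subseteq> factors G \<sigma>"
  shows "\<exists>z\<in>\<Sigma>. factors G z = B"
proof -
  obtain F where F: "F \<in> \<Sigma>" "F \<subseteq> \<sigma>" "\<And>a. a \<in> factors G \<sigma> \<Longrightarrow> F \<inter> a = (if a \<in> B then a else {0})"
  proof (rule gb_face_of_factors[OF \<sigma>])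
    fix a assume "a \<in> factors G \<sigma>"
    then show "(if a \<in> B then a else {0}) \<in> \<Sigma>" "(if a \<in> B then a else {0}) \<subseteq> a"
      using gb_factor zero_in_polyhedral_fan[OF gb_fan] fan_0[OF gb_fan] by auto
  qed (rule that)
  have "factors G F = B"
  proof (rule factors_eqI)
    show "B \<subseteq> G" using B factors_subset by blast
    show "antichain B" using antichain_subset[OF antichain_factors B] .
    show "b \<subseteq> F" if "b \<in> B" for b using F(3)[of b] B that by auto
    fix g assume g: "g \<in> G" "g \<subseteq> F"
    then obtain f where f: "f \<in> factors G \<sigma>" "g \<subseteq> f"
      using factors_above[OF gb_finite g(1), of \<sigma>] F(2) by blast
    then have "f \<in> B" using F(3)[OF f(1)] g gb_subset[OF g(1)] fan_0[OF gb_fan, of g]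
      by (auto split: if_splits)
    then show "\<exists>b\<in>B. g \<subseteq> b" using f by blast
  qed
  then show ?thesis using F(1) by blast
qed

end

section \<open>Stellar subdivision of a fan\<close>

locale stellar =
  fixes \<Sigma> :: "'a::euclidean_space set set" and \<tau> :: "'a set" and x :: 'a
  assumes admissible: "stellar_admissible \<Sigma> \<tau> x"
begin

lemma fan: "polyhedral_fan \<Sigma>"
  and \<tau>: "\<tau> \<in> \<Sigma>" "\<tau> \<noteq> {0}"
  and x_rel_interior: "x \<in> rel_interior \<tau>"
  using admissible unfolding stellar_admissible_def by blast+

lemma x_\<tau>: "x \<in> \<tau>"
  using x_rel_interior rel_interior_subset by blast

lemma x_nonzero: "x \<noteq> 0"
  using fan_rel_interior_nonzero[OF fan \<tau> x_rel_interior] .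

lemma x_mem_iff: "\<sigma> \<in> \<Sigma> \<Longrightarrow> x \<in> \<sigma> \<longleftrightarrow> \<tau> \<subseteq> \<sigma>"
  using fan_rel_interior[OF fan _ \<tau>(1) x_rel_interior] x_\<tau> by blast

abbreviation \<Sigma>' :: "'a set set" where
  "\<Sigma>' \<equiv> stellar_subdivision \<Sigma> \<tau> x"

text \<open>The closed star of \<tau> without the star itself: the cones over which the new ray is
  erected.\<close>

definition base :: "'a set \<Rightarrow> bool" where
  "base \<rho> \<longleftrightarrow> \<rho> \<in> \<Sigma> \<and> \<not> \<tau> \<subseteq> \<rho> \<and> (\<exists>\<sigma>\<in>\<Sigma>. \<tau> \<subseteq> \<sigma> \<and> \<rho> \<subseteq> \<sigma>)"

text \<open>A join in the sense of convex geometry, not the lattice join of the face poset.\<close>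

definition join :: "'a set \<Rightarrow> 'a set" where
  "join \<rho> = convex_cone hull (insert x \<rho>)"

lemma mem_stellar_subdivision_iff:
  "\<sigma> \<in> \<Sigma>' \<longleftrightarrow> (\<sigma> \<in> \<Sigma> \<and> \<not> \<tau> \<subseteq> \<sigma>) \<or> (\<exists>\<rho>. base \<rho> \<and> \<sigma> = join \<rho>)"
  unfolding stellar_subdivision_def star_def base_def join_def by auto

lemma base_\<Sigma>: "base \<rho> \<Longrightarrow> \<rho> \<in> \<Sigma>"
  unfolding base_def by blast

lemma base_mono: "base \<rho> \<Longrightarrow> F \<in> \<Sigma> \<Longrightarrow> F \<subseteq> \<rho> \<Longrightarrow> base F"
  unfolding base_def by blast

lemma base_zero: "base {0}"
  using zero_in_polyhedral_fan[OF fan] \<tau> fan_0[OF fan] unfolding base_def by blast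

lemma join_iff:
  assumes "base \<rho>"
  shows "y \<in> join \<rho> \<longleftrightarrow> (\<exists>a r. a \<ge> 0 \<and> r \<in> \<rho> \<and> y = a *\<^sub>R x + r)"
  unfolding join_def convex_cone_hull_insert[OF fan_convex_cone[OF fan base_\<Sigma>[OF assms]]] by blast

lemma convex_cone_join: "convex_cone (join \<rho>)"
  unfolding join_def by (rule convex_cone_convex_cone_hull)

lemma subset_join: "\<rho> \<subseteq> join \<rho>" and x_join: "x \<in> join \<rho>"
  unfolding join_def using hull_subset[of "insert x \<rho>" convex_cone] by blast+

text \<open>Some cone of the star contains both \<open>x\<close> and \<rho>, so \<sigma> absorbs the
  summand \<open>c *\<^sub>R x\<close>; a positive \<open>c\<close> would put \<open>x\<close>, and
  with it \<tau>, into \<sigma>. Uniqueness and intersections for the new cones rest on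
  this.\<close>

lemma base_coeff_zero:
  assumes \<rho>: "base \<rho>" and \<sigma>: "\<sigma> \<in> \<Sigma>" "\<not> \<tau> \<subseteq> \<sigma>" and c: "c \<ge> 0" "r \<in> \<rho>" "c *\<^sub>R x + r \<in> \<sigma>"
  shows "c = 0"
proof (rule ccontr)
  assume "c \<noteq> 0"
  obtain \<upsilon> where \<upsilon>: "\<upsilon> \<in> \<Sigma>" "\<tau> \<subseteq> \<upsilon>" "\<rho> \<subseteq> \<upsilon>" using \<rho> unfolding base_def by blast
  have "x \<in> \<upsilon>" using x_\<tau> \<upsilon>(2) by blast
  then have "c *\<^sub>R x \<in> \<upsilon>" using convex_cone_scaleR[OF fan_convex_cone[OF fan \<upsilon>(1)] c(1)] by blast
  then have "c *\<^sub>R x \<in> \<sigma>" using fan_absorb(1)[OF fan \<upsilon>(1) \<sigma>(1) _ _ c(3)] \<upsilon>(3) c(2) by blast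
  then have "x \<in> \<sigma>"
    using convex_cone_scaleR[OF fan_convex_cone[OF fan \<sigma>(1)], of "1/c" "c *\<^sub>R x"] \<open>c \<noteq> 0\<close> c(1) by simp
  then show False using x_mem_iff[OF \<sigma>(1)] \<sigma>(2) by blast
qed

text \<open>Cancelling the smaller multiple of \<open>x\<close> leaves a point of a base cone on one
  side, and \<open>base_coeff_zero\<close> makes the difference of the coefficients vanish. The two
  base cones may differ, as intersections of new cones require.\<close>

lemma join_unique:
  assumes "base \<rho>" "base \<rho>'" "r \<in> \<rho>" "r' \<in> \<rho>'" "a \<ge> 0" "b \<ge> 0" "a *\<^sub>R x + r = b *\<^sub>R x + r'"
  shows "a = b \<and> r = r'"
proof -
  have less: "a \<ge> b"
    if "base \<rho>" "base \<rho>'" "r \<in> \<rho>" "r' \<in> \<rho>'" "a *\<^sub>R x + r = b *\<^sub>R x + r'" for \<rho> \<rho>' r r' a b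
  proof (rule ccontr)
    assume "\<not> a \<ge> b"
    have "(b - a) *\<^sub>R x + r' = r"
      using that(5) by (simp add: scaleR_diff_left algebra_simps)
    then have "b - a = 0" using base_coeff_zero[OF that(2), of \<rho> "b - a" r'] that \<open>\<not> a \<ge> b\<close>
      unfolding base_def by auto
    then show False using \<open>\<not> a \<ge> b\<close> by simp
  qed
  have "a = b" using less[OF assms(1-4,7)] less[OF assms(2,1,4,3) assms(7)[symmetric]] by simp
  then show ?thesis using assms(7) by simp
qed

lemma pointed_join:
  assumes "base \<rho>"
  shows "pointed_polyhedral_cone (join \<rho>)"
proof -
  note P = pointed_coneD[OF fan_pointed[OF fan base_\<Sigma>[OF assms]]]
  have \<rho>: "\<rho> \<in> \<Sigma>" "\<not> \<tau> \<subseteq> \<rho>" using assms unfolding base_def by blast+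
  \<comment> \<open>A relation \<open>x = r - s\<close> would read
    \<open>1 *\<^sub>R x + s = r\<close>, a point of \<rho> with nonzero coefficient of
    \<open>x\<close>.\<close>
  have "x \<notin> span \<rho>"
  proof
    assume "x \<in> span \<rho>"
    then obtain r s where "r \<in> \<rho>" "s \<in> \<rho>" "x = r - s" using span_convex_cone[OF P(1)] by blast
    then show False using base_coeff_zero[OF assms \<rho>, of 1 s] by simp
  qed
  then have "polyhedron (join \<rho>)" unfolding join_def by (rule polyhedron_join_ray[OF P(1,3)])
  moreover have "y = 0" if y: "y \<in> join \<rho>" "- y \<in> join \<rho>" for y
  proof -
    obtain a r where a: "a \<ge> 0" "r \<in> \<rho>" "y = a *\<^sub>R x + r" using y(1) join_iff[OF assms] by blast
    obtain b s where b: "b \<ge> 0" "s \<in> \<rho>" "- y = b *\<^sub>R x + s" using y(2) join_iff[OF assms] by blast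
    have "(a + b) *\<^sub>R x + (r + s) = (a *\<^sub>R x + r) + (b *\<^sub>R x + s)"
      by (simp add: scaleR_add_left)
    also have "\<dots> = 0" unfolding a(3)[symmetric] b(3)[symmetric] by simp
    finally have eq: "(a + b) *\<^sub>R x + (r + s) = 0" .
    have "a + b = 0"
      by (rule base_coeff_zero[OF assms \<rho>, of "a + b" "r + s"])
        (use eq a b convex_cone_add[OF P(1)] convex_cone_contains_0[OF P(1)] in auto)
    then have "a = 0" "r + s = 0" using a b eq by auto
    then have "r = 0" using P(4) a b by (metis add.inverse_unique)
    then show ?thesis using a \<open>a = 0\<close> by simp
  qed
  then have "join \<rho> \<inter> uminus ` join \<rho> = {0}"
    using convex_cone_contains_0[OF convex_cone_join, of \<rho>] by (auto simp: image_iff)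
  ultimately show ?thesis
    using convex_cone_join unfolding pointed_polyhedral_cone_def by blast
qed

section \<open>Faces and intersections of the new cones\<close>

lemma face_of_join_left:
  assumes \<rho>: "base \<rho>" and F: "F \<in> \<Sigma>" "F \<subseteq> \<rho>"
  shows "F face_of join \<rho>"
proof -
  have Ff: "F face_of \<rho>" using fan_subset_face[OF fan F(1) base_\<Sigma>[OF \<rho>] F(2)] .
  have ne: "F \<noteq> {}" using fan_0[OF fan F(1)] by blast
  have F\<tau>: "\<not> \<tau> \<subseteq> F" using base_mono[OF \<rho> F] unfolding base_def by blast
  have cc: "convex_cone \<rho>" using fan_convex_cone[OF fan base_\<Sigma>[OF \<rho>]] .
  note Fc = face_of_coneD[OF Ff ne cc]
  have "p \<in> F" if "p \<in> join \<rho>" "q \<in> join \<rho>" and pq: "p + q \<in> F" for p q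
  proof -
    obtain a r where a: "a \<ge> 0" "r \<in> \<rho>" "p = a *\<^sub>R x + r" using \<open>p \<in> _\<close> join_iff[OF \<rho>] by blast
    obtain b s where b: "b \<ge> 0" "s \<in> \<rho>" "q = b *\<^sub>R x + s" using \<open>q \<in> _\<close> join_iff[OF \<rho>] by blast
    have eq: "p + q = (a + b) *\<^sub>R x + (r + s)" using a b by (simp add: scaleR_add_left)
    have F': "(a + b) *\<^sub>R x + (r + s) \<in> F" using pq unfolding eq .
    have "a + b = 0"
      using base_coeff_zero[OF \<rho> F(1) F\<tau> _ convex_cone_add[OF cc a(2) b(2)] F'] a b by simp
    then have "a = 0" "r + s \<in> F" using a b F' by auto
    then show ?thesis using Fc(3)[OF a(2) b(2)] a by simp
  qed
  then show ?thesis
    using fan_convex_cone[OF fan F(1)] F(2) subset_join by (subst face_of_cone_iff[OF convex_cone_join ne]) blast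
qed

lemma join_face_of_join:
  assumes \<rho>: "base \<rho>" and F: "F \<in> \<Sigma>" "F \<subseteq> \<rho>"
  shows "join F face_of join \<rho>"
proof -
  have Ff: "F face_of \<rho>" using fan_subset_face[OF fan F(1) base_\<Sigma>[OF \<rho>] F(2)] .
  have ne: "F \<noteq> {}" using fan_0[OF fan F(1)] by blast
  have bF: "base F" using base_mono[OF \<rho> F] .
  have cc: "convex_cone \<rho>" using fan_convex_cone[OF fan base_\<Sigma>[OF \<rho>]] .
  note Fc = face_of_coneD[OF Ff ne cc]
  have "p \<in> join F" if "p \<in> join \<rho>" "q \<in> join \<rho>" and pq: "p + q \<in> join F" for p q
  proof -
    obtain a r where a: "a \<ge> 0" "r \<in> \<rho>" "p = a *\<^sub>R x + r" using \<open>p \<in> _\<close> join_iff[OF \<rho>] by blast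
    obtain b s where b: "b \<ge> 0" "s \<in> \<rho>" "q = b *\<^sub>R x + s" using \<open>q \<in> _\<close> join_iff[OF \<rho>] by blast
    obtain c f where c: "c \<ge> 0" "f \<in> F" "p + q = c *\<^sub>R x + f" using pq join_iff[OF bF] by blast
    have "(a + b) *\<^sub>R x + (r + s) = p + q" using a b by (simp add: scaleR_add_left)
    then have "(a + b) *\<^sub>R x + (r + s) = c *\<^sub>R x + f" unfolding c(3) .
    then have "r + s = f"
      using join_unique[OF \<rho> bF, of "r + s" f "a + b" c] a b c convex_cone_add[OF cc] by auto
    then have "r \<in> F" using Fc(3)[OF a(2) b(2)] c by simp
    then show ?thesis using a join_iff[OF bF] by blast
  qed
  moreover have "join F \<subseteq> join \<rho>" unfolding join_def using F(2) by (intro hull_mono) auto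
  moreover have "join F \<noteq> {}" using x_join by blast
  ultimately show ?thesis
    using convex_cone_join face_of_cone_iff[OF convex_cone_join, of "join F" \<rho>] by blast
qed

text \<open>A point of \<open>F\<close> splits into a multiple of \<open>x\<close> and a point of
  \<rho>, both again in \<open>F\<close>. So \<open>F\<close> is
  \<open>join (F \<inter> \<rho>)\<close> if it contains \<open>x\<close>, and
  \<open>F \<inter> \<rho>\<close> otherwise.\<close>

lemma face_of_join_cases:
  assumes \<rho>: "base \<rho>" and F: "F face_of join \<rho>" "F \<noteq> {}"
  shows "F \<in> \<Sigma>'"
proof -
  note Fc = face_of_coneD[OF F convex_cone_join]
  have \<rho>\<Sigma>: "\<rho> \<in> \<Sigma>" using base_\<Sigma>[OF \<rho>] .
  have "(F \<inter> \<rho>) face_of \<rho>"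
    using face_of_slice[OF F(1), of \<rho>] fan_convex_cone[OF fan \<rho>\<Sigma>] subset_join[of \<rho>]
    by (simp add: convex_cone_def Int_absorb1)
  moreover have "0 \<in> F \<inter> \<rho>" using convex_cone_contains_0[OF Fc(1)] fan_0[OF fan \<rho>\<Sigma>] by blast
  ultimately have F\<rho>: "F \<inter> \<rho> \<in> \<Sigma>" using fan_face[OF fan \<rho>\<Sigma>] by blast
  have bF: "base (F \<inter> \<rho>)" using base_mono[OF \<rho> F\<rho>] by blast
  have parts: "\<exists>a r. a \<ge> 0 \<and> r \<in> F \<inter> \<rho> \<and> a *\<^sub>R x \<in> F \<and> y = a *\<^sub>R x + r" if y: "y \<in> F" for y
  proof -
    obtain a r where a: "a \<ge> 0" "r \<in> \<rho>" "y = a *\<^sub>R x + r" using y Fc(2) join_iff[OF \<rho>] by blast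
    have "a *\<^sub>R x \<in> join \<rho>" using convex_cone_scaleR[OF convex_cone_join a(1) x_join] .
    moreover have "r \<in> join \<rho>" using a(2) subset_join by blast
    ultimately have "a *\<^sub>R x \<in> F" "r \<in> F" using Fc(3,4) y a(3) by blast+
    then show ?thesis using a by blast
  qed
  show ?thesis
  proof (cases "x \<in> F")
    case True
    have "F = join (F \<inter> \<rho>)"
    proof
      show "F \<subseteq> join (F \<inter> \<rho>)" using parts join_iff[OF bF] by blast
      show "join (F \<inter> \<rho>) \<subseteq> F" unfolding join_def using True Fc(1) by (intro hull_minimal) auto
    qed
    then show ?thesis using bF unfolding mem_stellar_subdivision_iff by blast
  next
    case False
    have "y \<in> F \<inter> \<rho>" if y: "y \<in> F" for y
    proof -
      obtain a r where a: "a \<ge> 0" "r \<in> F \<inter> \<rho>" "a *\<^sub>R x \<in> F" "y = a *\<^sub>R x + r" using parts[OF y] by blast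
      have "a = 0"
      proof (rule ccontr)
        assume "a \<noteq> 0"
        then have "x \<in> F" using convex_cone_scaleR[OF Fc(1), of "1/a" "a *\<^sub>R x"] a by simp
        then show False using False by simp
      qed
      then show ?thesis using a by simp
    qed
    then have "F = F \<inter> \<rho>" by blast
    then show ?thesis using bF unfolding mem_stellar_subdivision_iff base_def by metis
  qed
qed

lemma join_Int_old:
  assumes \<rho>: "base \<rho>" and \<sigma>: "\<sigma> \<in> \<Sigma>" "\<not> \<tau> \<subseteq> \<sigma>"
  shows "join \<rho> \<inter> \<sigma> = \<rho> \<inter> \<sigma>"
proof
  show "join \<rho> \<inter> \<sigma> \<subseteq> \<rho> \<inter> \<sigma>"
  proof
    fix y assume y: "y \<in> join \<rho> \<inter> \<sigma>"
    then obtain a r where a: "a \<ge> 0" "r \<in> \<rho>" "y = a *\<^sub>R x + r" using join_iff[OF \<rho>] by blast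
    then have "a = 0" using base_coeff_zero[OF \<rho> \<sigma> a(1,2)] y by simp
    then show "y \<in> \<rho> \<inter> \<sigma>" using a y by simp
  qed
qed (use subset_join in blast)

lemma join_Int_join:
  assumes \<rho>: "base \<rho>" and \<rho>': "base \<rho>'"
  shows "join \<rho> \<inter> join \<rho>' = join (\<rho> \<inter> \<rho>')"
proof
  have b: "base (\<rho> \<inter> \<rho>')"
    using base_mono[OF \<rho> fan_Int[OF fan base_\<Sigma>[OF \<rho>] base_\<Sigma>[OF \<rho>']]] by blast
  show "join \<rho> \<inter> join \<rho>' \<subseteq> join (\<rho> \<inter> \<rho>')"
  proof
    fix y assume y: "y \<in> join \<rho> \<inter> join \<rho>'"
    then obtain a r where a: "a \<ge> 0" "r \<in> \<rho>" "y = a *\<^sub>R x + r" using join_iff[OF \<rho>] by blast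
    from y obtain a' r' where a': "a' \<ge> 0" "r' \<in> \<rho>'" "y = a' *\<^sub>R x + r'" using join_iff[OF \<rho>'] by blast
    have "r = r'" using join_unique[OF \<rho> \<rho>' a(2) a'(2) a(1) a'(1)] a(3) a'(3) by simp
    then show "y \<in> join (\<rho> \<inter> \<rho>')" using a a' join_iff[OF b] by blast
  qed
  show "join (\<rho> \<inter> \<rho>') \<subseteq> join \<rho> \<inter> join \<rho>'"
    unfolding join_def by (intro Int_greatest hull_mono) auto
qed

lemma polyhedral_fan_stellar: "polyhedral_fan \<Sigma>'"
  unfolding polyhedral_fan_def
proof (intro conjI ballI allI impI)
  have "\<Sigma>' \<subseteq> \<Sigma> \<union> join ` \<Sigma>" using mem_stellar_subdivision_iff base_\<Sigma> by blast
  then show "finite \<Sigma>'" using fan_finite[OF fan] finite_subset by blast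
  show "\<Sigma>' \<noteq> {}" using base_zero mem_stellar_subdivision_iff by blast
  show "pointed_polyhedral_cone \<sigma>" if "\<sigma> \<in> \<Sigma>'" for \<sigma>
    using that pointed_join fan_pointed[OF fan] unfolding mem_stellar_subdivision_iff by blast
  show "F \<in> \<Sigma>'" if "\<sigma> \<in> \<Sigma>'" and F: "F face_of \<sigma> \<and> F \<noteq> {}" for \<sigma> F
  proof -
    consider "\<sigma> \<in> \<Sigma>" "\<not> \<tau> \<subseteq> \<sigma>" | \<rho> where "base \<rho>" "\<sigma> = join \<rho>"
      using \<open>\<sigma> \<in> \<Sigma>'\<close> mem_stellar_subdivision_iff by blast
    then show ?thesis
    proof cases
      case 1
      have "F \<subseteq> \<sigma>" using F face_of_imp_subset by blast
      then show ?thesis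
        using 1 fan_face[OF fan, of \<sigma> F] F unfolding mem_stellar_subdivision_iff by blast
    next
      case 2
      then show ?thesis using face_of_join_cases F by blast
    qed
  qed
  have old_old: "\<sigma> \<inter> \<sigma>' face_of \<sigma>" if "\<sigma> \<in> \<Sigma>" "\<sigma>' \<in> \<Sigma>" for \<sigma> \<sigma>'
    using fan_Int_face[OF fan that] .
  have new_old: "join \<rho> \<inter> \<sigma> face_of join \<rho>" "join \<rho> \<inter> \<sigma> face_of \<sigma>"
    if "base \<rho>" "\<sigma> \<in> \<Sigma>" "\<not> \<tau> \<subseteq> \<sigma>" for \<rho> \<sigma>
    unfolding join_Int_old[OF that]
    using face_of_join_left[OF that(1) fan_Int[OF fan base_\<Sigma>[OF that(1)] that(2)]]
      old_old[OF that(2) base_\<Sigma>[OF that(1)]] by (auto simp: Int_commute)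
  have new_new: "join \<rho> \<inter> join \<rho>' face_of join \<rho>" if "base \<rho>" "base \<rho>'" for \<rho> \<rho>'
    unfolding join_Int_join[OF that]
    using join_face_of_join[OF that(1) fan_Int[OF fan base_\<Sigma>[OF that(1)] base_\<Sigma>[OF that(2)]]] by blast
  have int: "\<sigma> \<inter> \<sigma>' face_of \<sigma>" if s: "\<sigma> \<in> \<Sigma>'" "\<sigma>' \<in> \<Sigma>'" for \<sigma> \<sigma>'
  proof -
    have s1: "(\<sigma> \<in> \<Sigma> \<and> \<not> \<tau> \<subseteq> \<sigma>) \<or> (\<exists>\<rho>. base \<rho> \<and> \<sigma> = join \<rho>)"
      using s(1) unfolding mem_stellar_subdivision_iff .
    have s2: "(\<sigma>' \<in> \<Sigma> \<and> \<not> \<tau> \<subseteq> \<sigma>') \<or> (\<exists>\<rho>. base \<rho> \<and> \<sigma>' = join \<rho>)"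
      using s(2) unfolding mem_stellar_subdivision_iff .
    from s1 show ?thesis
    proof (elim disjE exE conjE)
      assume 1: "\<sigma> \<in> \<Sigma>" "\<not> \<tau> \<subseteq> \<sigma>"
      from s2 show ?thesis
        using old_old[OF 1(1)] new_old(2)[OF _ 1] by (metis Int_commute)
    next
      fix \<rho> assume 1: "base \<rho>" "\<sigma> = join \<rho>"
      from s2 show ?thesis
        using new_old(1)[OF 1(1)] new_new[OF 1(1)] unfolding 1(2) by metis
    qed
  qed
  fix \<sigma> \<sigma>' assume "\<sigma> \<in> \<Sigma>'" "\<sigma>' \<in> \<Sigma>'"
  then show "\<sigma> \<inter> \<sigma>' face_of \<sigma>" "\<sigma> \<inter> \<sigma>' face_of \<sigma>'"
    using int[of \<sigma> \<sigma>'] int[of \<sigma>' \<sigma>] by (simp_all add: Int_commute)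
qed

lemma stellar_refines:
  assumes "\<sigma>' \<in> \<Sigma>'"
  shows "\<exists>\<sigma>\<in>\<Sigma>. \<sigma>' \<subseteq> \<sigma>"
proof -
  consider "\<sigma>' \<in> \<Sigma>" | \<rho> where "base \<rho>" "\<sigma>' = join \<rho>"
    using assms mem_stellar_subdivision_iff by blast
  then show ?thesis
  proof cases
    case 2
    then obtain \<sigma> where \<sigma>: "\<sigma> \<in> \<Sigma>" "\<tau> \<subseteq> \<sigma>" "\<rho> \<subseteq> \<sigma>" unfolding base_def by blast
    then have "insert x \<rho> \<subseteq> \<sigma>" using x_\<tau> by blast
    then have "join \<rho> \<subseteq> \<sigma>" unfolding join_def using fan_convex_cone[OF fan \<sigma>(1)] by (intro hull_minimal)
    then show ?thesis using \<sigma>(1) 2 by blast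
  qed blast
qed

text \<open>For the covering, a point in a cone of the star is pushed in direction
  \<open>- x\<close> into a face without \<open>x\<close>. That face is a base cone, and the point
  lies in the new cone over it.\<close>

lemma fan_subdivision_stellar: "fan_subdivision \<Sigma>' \<Sigma>"
proof -
  have "\<Union>\<Sigma> \<subseteq> \<Union>\<Sigma>'"
  proof
    fix y assume "y \<in> \<Union>\<Sigma>"
    then obtain \<sigma> where \<sigma>: "\<sigma> \<in> \<Sigma>" "y \<in> \<sigma>" by blast
    show "y \<in> \<Union>\<Sigma>'"
    proof (cases "\<tau> \<subseteq> \<sigma>")
      case True
      then have "x \<in> \<sigma>" using x_\<tau> by blast
      then obtain a \<rho> where \<rho>: "a \<ge> 0" "\<rho> \<in> \<Sigma>" "\<rho> \<subseteq> \<sigma>" "y - a *\<^sub>R x \<in> \<rho>" "x \<notin> \<rho>"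
        using fan_push[OF fan \<sigma>(1) _ x_nonzero \<sigma>(2)] by blast
      then have "base \<rho>" using True \<sigma>(1) x_mem_iff unfolding base_def by blast
      moreover have "y = a *\<^sub>R x + (y - a *\<^sub>R x)" by simp
      ultimately have "y \<in> join \<rho>" using \<rho> join_iff by blast
      then show ?thesis using \<open>base \<rho>\<close> mem_stellar_subdivision_iff by blast
    next
      case False
      then show ?thesis using \<sigma> mem_stellar_subdivision_iff by blast
    qed
  qed
  then show ?thesis
    using polyhedral_fan_stellar stellar_refines unfolding fan_subdivision_def by blast
qed

end

section \<open>Stellar subdivision in a maximal element of the building set\<close>

text \<open>Uniqueness of the multiple of \<open>x\<close> separates the ray component from a
  remainder in \<rho>, which \<open>A\<close> splits uniquely. The ray must be a new summand because
  summands are their own indices.\<close>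

lemma direct_sum_insert_ray:
  assumes A: "direct_sum A \<rho>" and r: "r = {c *\<^sub>R x | c. c \<ge> 0}" "r \<notin> A" and x: "x \<noteq> 0"
    and z: "\<And>y. y \<in> z \<longleftrightarrow> (\<exists>a s. a \<ge> 0 \<and> s \<in> \<rho> \<and> y = a *\<^sub>R x + s)"
    and unique: "\<And>a b s s'. a \<ge> 0 \<Longrightarrow> b \<ge> 0 \<Longrightarrow> s \<in> \<rho> \<Longrightarrow> s' \<in> \<rho> \<Longrightarrow>
        a *\<^sub>R x + s = b *\<^sub>R x + s' \<Longrightarrow> a = b \<and> s = s'"
  shows "direct_sum (insert r A) z"
proof -
  have fin: "finite A" and \<rho>: "\<rho> = {\<Sum>a\<in>A. v a | v. \<forall>a\<in>A. v a \<in> a}"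
    using A unfolding direct_sum_def by blast+
  have sum_insert: "sum v (insert r A) = v r + sum v A" for v :: "'a set \<Rightarrow> 'a"
    using fin r(2) by simp
  have "z = {\<Sum>a\<in>insert r A. v a | v. \<forall>a\<in>insert r A. v a \<in> a}" (is "_ = ?Z")
  proof (intro equalityI subsetI)
    fix y assume "y \<in> z"
    then obtain a s where a: "a \<ge> 0" "s \<in> \<rho>" "y = a *\<^sub>R x + s" using z by blast
    then obtain v where v: "\<forall>a\<in>A. v a \<in> a" "s = sum v A" using \<rho> by blast
    define w where "w = v(r := a *\<^sub>R x)"
    have "sum w A = sum v A" unfolding w_def using r(2) by (intro sum.cong) auto
    then have "y = sum w (insert r A)" using a v by (simp add: sum_insert w_def)
    moreover have "\<forall>a\<in>insert r A. w a \<in> a" using v r a(1) unfolding w_def by auto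
    ultimately show "y \<in> ?Z" by blast
  next
    fix y assume "y \<in> ?Z"
    then obtain v where v: "\<forall>a\<in>insert r A. v a \<in> a" "y = sum v (insert r A)" by blast
    have "v r \<in> {c *\<^sub>R x | c. c \<ge> 0}" using v(1) r(1) by (metis insertI1)
    then obtain c where "c \<ge> 0" "v r = c *\<^sub>R x" by blast
    moreover have "sum v A \<in> \<rho>" using v(1) \<rho> by blast
    ultimately show "y \<in> z" using z v(2) sum_insert by metis
  qed
  moreover have "u b = v b"
    if uv: "\<forall>a\<in>insert r A. u a \<in> a \<and> v a \<in> a" "sum u (insert r A) = sum v (insert r A)"
      and b: "b \<in> insert r A" for u v b
  proof -
    have "u r \<in> {c *\<^sub>R x | c. c \<ge> 0}" "v r \<in> {c *\<^sub>R x | c. c \<ge> 0}"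
      using uv(1) r(1) by (metis insertI1)+
    then obtain c d where c: "c \<ge> 0" "u r = c *\<^sub>R x" and d: "d \<ge> 0" "v r = d *\<^sub>R x" by blast
    have "sum u A \<in> \<rho>" "sum v A \<in> \<rho>" using uv(1) \<rho> by blast+
    then have "c = d \<and> sum u A = sum v A"
      using unique[OF c(1) d(1)] uv(2) c(2) d(2) sum_insert by metis
    then show ?thesis using b c d direct_sum_unique[OF A, of u v b] uv(1) by auto
  qed
  ultimately show ?thesis using fin unfolding direct_sum_def by blast
qed

lemma factors_cong:
  assumes "\<And>g. g \<le> z \<Longrightarrow> g \<in> G \<longleftrightarrow> g \<in> G'"
  shows "factors G z = factors G' z"
  using assms unfolding factors_def by blast

text \<open>Inside \<sigma>, where maximality makes \<tau> a factor, keep \<tau> whole and intersect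
  every other factor with \<rho>. The hypothesis \<open>nle\<close> makes \<tau> and the factors of
  \<rho> an antichain. This leads from nested sets through the new ray back to nested sets through
  \<tau>.\<close>

lemma maximal_factor_join:
  assumes gb: "geometric_building_set \<Sigma> G"
    and \<tau>: "\<tau> \<in> G" "\<And>g. g \<in> G \<Longrightarrow> \<tau> \<subseteq> g \<Longrightarrow> g = \<tau>"
    and \<sigma>: "\<sigma> \<in> \<Sigma>" "\<tau> \<subseteq> \<sigma>" and \<rho>: "\<rho> \<in> \<Sigma>" "\<rho> \<subseteq> \<sigma>" "\<not> \<tau> \<subseteq> \<rho>"
    and nle: "\<And>b. b \<in> factors G \<rho> \<Longrightarrow> \<not> b \<subseteq> \<tau>"
  shows "\<exists>z\<in>\<Sigma>. factors G z = insert \<tau> (factors G \<rho>)"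
proof -
  note fin = gb_finite[OF gb] and fan = gb_fan[OF gb] and fac = gb_factor[OF gb]
  obtain f where "f \<in> factors G \<sigma>" "\<tau> \<subseteq> f" using factors_above[OF fin \<tau>(1) \<sigma>(2)] by blast
  then have \<tau>f: "\<tau> \<in> factors G \<sigma>" using \<tau>(2) factors_subset by blast
  define Q where "Q a = (if a = \<tau> then \<tau> else \<rho> \<inter> a)" for a
  have Q: "Q a \<in> \<Sigma>" "Q a \<subseteq> a" if "a \<in> factors G \<sigma>" for a
    unfolding Q_def using fan_Int[OF fan \<rho>(1) fac[OF that]] fac[OF that] by auto
  obtain F where F: "F \<in> \<Sigma>" "F \<subseteq> \<sigma>" "\<And>a. a \<in> factors G \<sigma> \<Longrightarrow> F \<inter> a = Q a"
    by (rule gb_face_of_factors[OF gb \<sigma>(1), where Q = Q]) (assumption | rule Q that)+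
  have "factors G F = insert \<tau> (factors G \<rho>)"
  proof (rule factors_eqI)
    show "insert \<tau> (factors G \<rho>) \<subseteq> G" using \<tau>(1) factors_subset by blast
    have "\<not> \<tau> \<subseteq> b" if "b \<in> factors G \<rho>" for b using that \<rho>(3) factors_le by blast
    then show "antichain (insert \<tau> (factors G \<rho>))"
      using antichain_factors[of G \<rho>] nle unfolding antichain_def by blast
    fix b assume "b \<in> insert \<tau> (factors G \<rho>)"
    then consider "b = \<tau>" | "b \<in> factors G \<rho>" by blast
    then show "b \<subseteq> F"
    proof cases
      case 1
      then show ?thesis using F(3)[OF \<tau>f] unfolding Q_def by auto
    next
      case 2
      then have b: "b \<in> G" "b \<subseteq> \<rho>" using factors_subset factors_le by blast+
      then obtain f where f: "f \<in> factors G \<sigma>" "b \<subseteq> f"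
        using factors_above[OF fin b(1), of \<sigma>] \<rho>(2) by blast
      then have "f \<noteq> \<tau>" using nle[OF 2] by blast
      then show ?thesis using F(3)[OF f(1)] b f(2) unfolding Q_def by auto
    qed
  next
    fix g assume g: "g \<in> G" "g \<subseteq> F"
    then obtain f where f: "f \<in> factors G \<sigma>" "g \<subseteq> f"
      using factors_above[OF fin g(1), of \<sigma>] F(2) by blast
    show "\<exists>b\<in>insert \<tau> (factors G \<rho>). g \<subseteq> b"
    proof (cases "f = \<tau>")
      case False
      then have "g \<subseteq> \<rho>" using F(3)[OF f(1)] g f(2) unfolding Q_def by auto
      then obtain b where "b \<in> factors G \<rho>" "g \<subseteq> b" using factors_above[OF fin g(1)] by blast
      then show ?thesis by blast
    qed (use f in blast)
  qed
  then show ?thesis using F(1) by blast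
qed

locale stellar_maximal = stellar +
  fixes G :: "'a set set"
  assumes gb: "geometric_building_set \<Sigma> G"
    and \<tau>G: "\<tau> \<in> G" and maximal: "\<And>g. g \<in> G \<Longrightarrow> \<tau> \<subseteq> g \<Longrightarrow> g = \<tau>"
begin

definition ray :: "'a set" where
  "ray = convex_cone hull {x}"

definition G' :: "'a set set" where
  "G' = insert ray (G - {\<tau>})"

lemma ray_eq: "ray = {c *\<^sub>R x | c. c \<ge> 0}"
  unfolding ray_def by (rule convex_cone_hull_singleton)

lemma x_ray: "x \<in> ray"
  unfolding ray_def by (simp add: hull_inc)

lemma ray_subset_iff: "convex_cone \<sigma> \<Longrightarrow> ray \<subseteq> \<sigma> \<longleftrightarrow> x \<in> \<sigma>"
  using x_ray hull_minimal[of "{x}" \<sigma> convex_cone] unfolding ray_def by blast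

lemma ray_eq_join: "ray = join {0}"
  unfolding ray_eq using join_iff[OF base_zero] by auto

lemma subset_ray:
  assumes "\<sigma> \<in> \<Sigma>" "\<sigma> \<noteq> {0}" "\<sigma> \<subseteq> ray"
  shows "x \<in> \<sigma>"
proof -
  obtain y where y: "y \<in> \<sigma>" "y \<noteq> 0" using assms(1,2) fan_0[OF fan] by blast
  then obtain c where c: "c \<ge> 0" "y = c *\<^sub>R x" using assms(3) ray_eq by blast
  then have "(1/c) *\<^sub>R y \<in> \<sigma>" using y by (intro convex_cone_scaleR[OF fan_convex_cone[OF fan assms(1)]]) auto
  then show ?thesis using c y by auto
qed

text \<open>Maximality keeps every remaining element out of the star of \<tau>. It is incomparable
  with the ray, since containment either way would put \<open>x\<close> into it.\<close>

lemma other: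
  assumes "g \<in> G - {\<tau>}"
  shows "g \<in> \<Sigma>" "\<not> \<tau> \<subseteq> g" "x \<notin> g" "\<not> ray \<subseteq> g" "\<not> g \<subseteq> ray"
proof -
  show g: "g \<in> \<Sigma>" using assms gb_subset[OF gb] by blast
  show n: "\<not> \<tau> \<subseteq> g" using assms maximal by blast
  then show x: "x \<notin> g" using x_mem_iff[OF g] by blast
  show "\<not> ray \<subseteq> g" using x x_ray by blast
  show "\<not> g \<subseteq> ray" using subset_ray[OF g] x assms gb_subset[OF gb] by blast
qed

text \<open>The element \<tau> is excepted because the new ray equals \<tau> when \<tau> is itself a
  ray.\<close>

lemma ray_notin: "ray \<notin> G - {\<tau>}"
  using other(4)[of ray] by blast

lemma \<tau>_subset_iff:
  assumes "z \<in> \<Sigma>"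
  shows "\<tau> \<subseteq> z \<longleftrightarrow> \<tau> \<in> factors G z"
proof
  assume "\<tau> \<subseteq> z"
  then obtain f where "f \<in> factors G z" "\<tau> \<subseteq> f" using factors_above[OF gb_finite[OF gb] \<tau>G] by blast
  then show "\<tau> \<in> factors G z" using maximal factors_subset by blast
qed (rule factors_le)

lemma factors_old:
  assumes "z \<in> \<Sigma>" "\<not> \<tau> \<subseteq> z"
  shows "factors G' z = factors G z"
proof (rule factors_cong)
  fix g assume g: "g \<subseteq> z"
  have "x \<notin> z" using assms x_mem_iff by blast
  then have "g \<noteq> ray" "g \<noteq> \<tau>" using g assms(2) x_ray by blast+
  then show "g \<in> G' \<longleftrightarrow> g \<in> G" unfolding G'_def by blast
qed

text \<open>An element of \<open>G\<close> other than \<tau> is an old cone outside the star and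
  meets \<open>join \<rho>\<close> inside \<rho>. So the ray is the only addition below
  \<open>join \<rho>\<close>.\<close>

lemma factors_join:
  assumes \<rho>: "base \<rho>"
  shows "factors G' (join \<rho>) = insert ray (factors G \<rho>)"
proof (rule factors_eqI)
  have \<rho>': "\<rho> \<in> \<Sigma>" "\<not> \<tau> \<subseteq> \<rho>" using \<rho> unfolding base_def by blast+
  have f: "a \<in> G - {\<tau>}" if "a \<in> factors G \<rho>" for a
    using that \<tau>_subset_iff[OF \<rho>'(1)] \<rho>'(2) factors_subset by blast
  then show "insert ray (factors G \<rho>) \<subseteq> G'" unfolding G'_def by blast
  show "antichain (insert ray (factors G \<rho>))"
    using antichain_factors[of G \<rho>] other(4,5)[OF f] unfolding antichain_def by blast
  show "b \<subseteq> join \<rho>" if "b \<in> insert ray (factors G \<rho>)" for b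
    using that x_join ray_subset_iff[OF convex_cone_join] subset_join[of \<rho>] factors_le[of b G \<rho>] by blast
  fix g assume g: "g \<in> G'" "g \<subseteq> join \<rho>"
  show "\<exists>b\<in>insert ray (factors G \<rho>). g \<subseteq> b"
  proof (cases "g = ray")
    case False
    then have gG: "g \<in> G - {\<tau>}" using g(1) unfolding G'_def by blast
    have "g \<subseteq> \<rho>" using join_Int_old[OF \<rho> other(1,2)[OF gG]] g(2) by blast
    then obtain b where "b \<in> factors G \<rho>" "g \<subseteq> b" using factors_above[OF gb_finite[OF gb]] gG by blast
    then show ?thesis by blast
  qed blast
qed

lemma ray_notin_factors:
  assumes "z \<in> \<Sigma>" "\<not> \<tau> \<subseteq> z"
  shows "ray \<notin> factors G z"
  using assms x_ray x_mem_iff factors_le[of ray G z] by blast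

lemma geometric_building_set_stellar: "geometric_building_set \<Sigma>' G'"
proof -
  have "ray \<in> \<Sigma>'" using ray_eq_join base_zero mem_stellar_subdivision_iff by blast
  moreover have "ray \<noteq> {0}" using x_ray x_nonzero by blast
  moreover have "g \<in> \<Sigma>'" "g \<noteq> {0}" if "g \<in> G - {\<tau>}" for g
    using that other(1,2) gb_subset(2)[OF gb] mem_stellar_subdivision_iff by blast+
  ultimately have "G' \<subseteq> \<Sigma>' - {{0}}" unfolding G'_def by blast
  moreover have "direct_sum (factors G' \<sigma>) \<sigma>" if \<sigma>: "\<sigma> \<in> \<Sigma>'" for \<sigma>
  proof -
    consider "\<sigma> \<in> \<Sigma>" "\<not> \<tau> \<subseteq> \<sigma>" | \<rho> where "base \<rho>" "\<sigma> = join \<rho>"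
      using \<sigma> mem_stellar_subdivision_iff by blast
    then show ?thesis
    proof cases
      case 1
      then show ?thesis using factors_old gb_direct_sum[OF gb] by simp
    next
      case 2
      have "ray \<notin> factors G \<rho>" using ray_notin_factors 2(1) unfolding base_def by blast
      then have "direct_sum (insert ray (factors G \<rho>)) (join \<rho>)"
        using direct_sum_insert_ray[OF gb_direct_sum[OF gb base_\<Sigma>[OF 2(1)]] ray_eq _ x_nonzero join_iff[OF 2(1)]]
          join_unique[OF 2(1) 2(1)] by blast
      then show ?thesis using factors_join 2 by simp
    qed
  qed
  ultimately show ?thesis using polyhedral_fan_stellar unfolding geometric_building_set_def by blast
qed

lemma factors_stellar_iff:
  "(\<exists>z\<in>\<Sigma>'. factors G' z = A) \<longleftrightarrow>
     (\<exists>z\<in>\<Sigma>. \<tau> \<notin> factors G z \<and> factors G z = A) \<or> (\<exists>\<rho>. base \<rho> \<and> A = insert ray (factors G \<rho>))"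
  using \<tau>_subset_iff factors_old factors_join mem_stellar_subdivision_iff by metis

lemma factors_stellar_old_iff:
  assumes "A \<subseteq> G - {\<tau>}"
  shows "(\<exists>z\<in>\<Sigma>'. factors G' z = A) \<longleftrightarrow> (\<exists>z\<in>\<Sigma>. factors G z = A)"
proof -
  have "ray \<notin> A" "\<tau> \<notin> A" using assms ray_notin by blast+
  then show ?thesis unfolding factors_stellar_iff by blast
qed

lemma factors_stellar_ray_iff:
  assumes "A \<subseteq> G - {\<tau>}"
  shows "(\<exists>z\<in>\<Sigma>'. factors G' z = insert ray A) \<longleftrightarrow> (\<exists>\<rho>. base \<rho> \<and> A = factors G \<rho>)"
proof -
  have A: "ray \<notin> A" using assms ray_notin by blast
  have "ray \<notin> factors G z" if "z \<in> \<Sigma>" "\<tau> \<notin> factors G z" for z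
    using that ray_notin_factors \<tau>_subset_iff by blast
  moreover have "ray \<notin> factors G \<rho>" if "base \<rho>" for \<rho>
    using that ray_notin_factors unfolding base_def by blast
  ultimately show ?thesis unfolding factors_stellar_iff using A by (metis insertI1 insert_ident)
qed

text \<open>The replacement changes comparability: elements below \<tau> are incomparable with the
  new ray. An antichain through the ray need not come from one through \<tau>, so the two directions
  need different arguments.\<close>

lemma factor_nested_stellar:
  assumes N: "N \<subseteq> G"
  shows "factor_nested \<Sigma>' G' ((\<lambda>g. if g = \<tau> then ray else g) ` N) \<longleftrightarrow> factor_nested \<Sigma> G N"
proof (cases "\<tau> \<in> N")
  case False
  then have "(\<lambda>g. if g = \<tau> then ray else g) ` N = N" by force
  moreover have N': "N \<subseteq> G - {\<tau>}" using N False by blast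
  have "(\<exists>z\<in>\<Sigma>'. factors G' z = A) \<longleftrightarrow> (\<exists>z\<in>\<Sigma>. factors G z = A)" if "A \<subseteq> N" for A
    using factors_stellar_old_iff that N' by (meson order_trans)
  moreover have "N \<subseteq> G'" using N' unfolding G'_def by blast
  ultimately show ?thesis using N unfolding factor_nested_def by simp
next
  case True
  define M where "M = N - {\<tau>}"
  have N': "(\<lambda>g. if g = \<tau> then ray else g) ` N = insert ray M" using True unfolding M_def by force
  have M: "M \<subseteq> G - {\<tau>}" using N unfolding M_def by blast
  show ?thesis
    unfolding N'
  proof
    assume n: "factor_nested \<Sigma>' G' (insert ray M)"
    show "factor_nested \<Sigma> G N"
      unfolding factor_nested_def
    proof (intro conjI allI impI N)
      fix A assume A: "A \<subseteq> N" "antichain A"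
      show "\<exists>z\<in>\<Sigma>. factors G z = A"
      proof (cases "\<tau> \<in> A")
        case False
        then have "A \<subseteq> M" using A(1) unfolding M_def by blast
        then show ?thesis
          using n A(2) M factors_stellar_old_iff[of A] unfolding factor_nested_def by blast
      next
        case True
        define B where "B = A - {\<tau>}"
        have B: "B \<subseteq> M" "antichain B" "\<And>b. b \<in> B \<Longrightarrow> \<not> b \<subseteq> \<tau>"
          using A True unfolding B_def M_def antichain_def by blast+
        have "antichain (insert ray B)"
          using B M other(4,5) unfolding antichain_def by blast
        moreover have "insert ray B \<subseteq> insert ray M" using B(1) by blast
        ultimately have "\<exists>z\<in>\<Sigma>'. factors G' z = insert ray B"
          using n unfolding factor_nested_def by blast
        then obtain \<rho> where \<rho>: "base \<rho>" "B = factors G \<rho>"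
          using factors_stellar_ray_iff[of B] B(1) M by blast
        then obtain \<sigma> where \<sigma>: "\<sigma> \<in> \<Sigma>" "\<tau> \<subseteq> \<sigma>" "\<rho> \<subseteq> \<sigma>" and \<rho>': "\<rho> \<in> \<Sigma>" "\<not> \<tau> \<subseteq> \<rho>"
          unfolding base_def by blast
        have "\<exists>z\<in>\<Sigma>. factors G z = insert \<tau> (factors G \<rho>)"
          by (rule maximal_factor_join[OF gb \<tau>G maximal \<sigma>(1,2) \<rho>'(1) \<sigma>(3) \<rho>'(2)])
            (use B(3) \<rho>(2) in blast)+
        then show ?thesis using True \<rho>(2) unfolding B_def by (metis insert_Diff)
      qed
    qed
  next
    assume n: "factor_nested \<Sigma> G N"
    show "factor_nested \<Sigma>' G' (insert ray M)"
      unfolding factor_nested_def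
    proof (intro conjI allI impI)
      show "insert ray M \<subseteq> G'" using M unfolding G'_def by blast
      fix A assume A: "A \<subseteq> insert ray M" "antichain A"
      show "\<exists>z\<in>\<Sigma>'. factors G' z = A"
      proof (cases "ray \<in> A")
        case False
        then have "A \<subseteq> M" using A(1) by blast
        then have "A \<subseteq> N" "A \<subseteq> G - {\<tau>}" using M unfolding M_def by blast+
        then show ?thesis
          using n A(2) factors_stellar_old_iff[of A] unfolding factor_nested_def by blast
      next
        case True
        define B where "B = A - {ray}"
        have B: "B \<subseteq> M" "antichain B"
          using A unfolding B_def by (auto intro: antichain_subset)
        then obtain \<rho> where \<rho>: "\<rho> \<in> \<Sigma>" "factors G \<rho> = B"
          using n unfolding factor_nested_def M_def by blast
        have n\<tau>: "\<not> \<tau> \<subseteq> \<rho>" using \<tau>_subset_iff[OF \<rho>(1)] \<rho>(2) B(1) unfolding M_def by blast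
        \<comment> \<open>Members of \<open>B\<close> below \<tau> are dropped to obtain an
          antichain with \<tau>. Its cone \<sigma> still contains them through \<tau>, so \<rho>
          lies in a cone of the star.\<close>
        have "antichain (insert \<tau> {b \<in> B. \<not> b \<subseteq> \<tau>})"
          using B M other(2) unfolding antichain_def by blast
        moreover have "insert \<tau> {b \<in> B. \<not> b \<subseteq> \<tau>} \<subseteq> N" using \<open>\<tau> \<in> N\<close> B(1) unfolding M_def by blast
        ultimately obtain \<sigma> where \<sigma>: "\<sigma> \<in> \<Sigma>" "factors G \<sigma> = insert \<tau> {b \<in> B. \<not> b \<subseteq> \<tau>}"
          using n unfolding factor_nested_def by blast
        have le: "a \<subseteq> \<sigma>" if "a \<in> insert \<tau> {b \<in> B. \<not> b \<subseteq> \<tau>}" for a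
          using that \<sigma>(2) factors_le by blast
        then have "a \<subseteq> \<sigma>" if "a \<in> factors G \<rho>" for a using that \<rho>(2) by blast
        then have "\<rho> \<subseteq> \<sigma>" using gb_subset_convex_cone[OF gb \<rho>(1) fan_convex_cone[OF fan \<sigma>(1)]] by blast
        then have "base \<rho>" using \<rho>(1) n\<tau> \<sigma>(1) le unfolding base_def by blast
        then have "\<exists>z\<in>\<Sigma>'. factors G' z = insert ray B" using factors_stellar_ray_iff[of B] B(1) M \<rho>(2) by blast
        then show ?thesis using True unfolding B_def by (simp add: insert_absorb)
      qed
    qed
  qed
qed

end

section \<open>Iterated stellar subdivision\<close>

definition relabel :: "('a::euclidean_space set \<Rightarrow> 'a) \<Rightarrow> 'a set set \<Rightarrow> 'a set \<Rightarrow> 'a set" where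
  "relabel p S g = (if g \<in> S then convex_cone hull {p g} else g)"

text \<open>Maximality of the head is split into two hypotheses that survive the induction: the list
  order handles the cones still to come, and the condition on \<open>G - set Gs\<close> handles the
  other elements, among them the rays already created.\<close>

lemma iterated_stellar:
  assumes "geometric_building_set \<Sigma> G" "set Gs \<subseteq> G" "distinct Gs" "sorted_wrt (\<lambda>a b. \<not> a \<subset> b) Gs"
    "\<And>g h. g \<in> G - set Gs \<Longrightarrow> h \<in> set Gs \<Longrightarrow> \<not> h \<subseteq> g"
    "\<And>h. h \<in> set Gs \<Longrightarrow> p h \<in> rel_interior h"
  shows "(\<forall>i<length Gs.
            stellar_admissible (stellar_subdivisions p (take i Gs) \<Sigma>) (Gs ! i) (p (Gs ! i))) \<and>
         geometric_building_set (stellar_subdivisions p Gs \<Sigma>) (relabel p (set Gs) ` G) \<and>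
         fan_subdivision (stellar_subdivisions p Gs \<Sigma>) \<Sigma> \<and>
         inj_on (relabel p (set Gs)) G \<and>
         (\<forall>N\<subseteq>G. factor_nested (stellar_subdivisions p Gs \<Sigma>) (relabel p (set Gs) ` G) (relabel p (set Gs) ` N)
            \<longleftrightarrow> factor_nested \<Sigma> G N)"
  using assms
proof (induction Gs arbitrary: \<Sigma> G)
  case Nil
  have "fan_subdivision \<Sigma> \<Sigma>" using gb_fan[OF Nil(1)] unfolding fan_subdivision_def by blast
  then show ?case using Nil(1) by (simp add: relabel_def)
next
  case (Cons \<tau> Gs)
  note prems = Cons.prems
  have \<tau>G: "\<tau> \<in> G" and \<tau>p: "p \<tau> \<in> rel_interior \<tau>" using prems(2,6) by auto
  have \<tau>Gs: "\<tau> \<notin> set Gs" using prems(3) by simp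
  interpret stellar_maximal \<Sigma> \<tau> "p \<tau>" G
  proof
    show "stellar_admissible \<Sigma> \<tau> (p \<tau>)"
      using \<tau>p gb_fan[OF prems(1)] gb_subset[OF prems(1) \<tau>G] unfolding stellar_admissible_def by blast
    show "g = \<tau>" if g: "g \<in> G" "\<tau> \<subseteq> g" for g
    proof (cases "g \<in> set (\<tau> # Gs)")
      case True
      then show ?thesis using prems(4) g(2) by auto
    next
      case False
      then show ?thesis using prems(5)[of g \<tau>] g by auto
    qed
  qed (fact prems(1) \<tau>G)+
  \<comment> \<open>\<open>f\<close> is the relabelling of one step. Followed by that of the tail it
    gives the whole relabelling, because the new ray is not on the remaining list.\<close>
  define f where "f g = (if g = \<tau> then ray else g)" for g
  have fG: "f ` G = G'" using \<tau>G unfolding f_def G'_def by auto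
  have Gs: "set Gs \<subseteq> G - {\<tau>}" using prems(2) \<tau>Gs by auto
  have rayGs: "ray \<notin> set Gs" using Gs ray_notin by blast
  have relabel: "relabel p (set (\<tau> # Gs)) g = relabel p (set Gs) (f g)" for g
    using rayGs \<tau>Gs unfolding relabel_def f_def ray_def by auto
  then have relabel_image: "relabel p (set (\<tau> # Gs)) ` N = relabel p (set Gs) ` (f ` N)" for N
    by (simp add: image_image)
  have inj: "inj_on f G" using ray_notin unfolding f_def inj_on_def by auto
  have new: "\<not> h \<subseteq> g" if "g \<in> G' - set Gs" "h \<in> set Gs" for g h
  proof (cases "g = ray")
    case True
    then show ?thesis using other(5) that(2) Gs by blast
  next
    case False
    then have "g \<in> G - set (\<tau> # Gs)" using that(1) unfolding G'_def by auto
    then show ?thesis using prems(5)[of g h] that(2) by simp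
  qed
  let ?\<Sigma> = "stellar_subdivisions p Gs \<Sigma>'"
  have sub: "set Gs \<subseteq> G'" using Gs unfolding G'_def by blast
  have dist: "distinct Gs" and sorted: "sorted_wrt (\<lambda>a b. \<not> a \<subset> b) Gs" using prems(3,4) by auto
  have pos: "\<And>h. h \<in> set Gs \<Longrightarrow> p h \<in> rel_interior h" using prems(6) by auto
  have adm: "\<forall>i<length Gs. stellar_admissible (stellar_subdivisions p (take i Gs) \<Sigma>') (Gs ! i) (p (Gs ! i))"
    and gb': "geometric_building_set ?\<Sigma> (relabel p (set Gs) ` G')"
    and subdiv: "fan_subdivision ?\<Sigma> \<Sigma>'"
    and inj': "inj_on (relabel p (set Gs)) G'"
    and nest: "\<forall>N\<subseteq>G'. factor_nested ?\<Sigma> (relabel p (set Gs) ` G') (relabel p (set Gs) ` N)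
            \<longleftrightarrow> factor_nested \<Sigma>' G' N"
    using Cons.IH[OF geometric_building_set_stellar sub dist sorted new pos] by blast+
  have "stellar_admissible (stellar_subdivisions p (take i (\<tau> # Gs)) \<Sigma>) ((\<tau> # Gs) ! i) (p ((\<tau> # Gs) ! i))"
    if "i < length (\<tau> # Gs)" for i
    using that adm admissible by (cases i) auto
  moreover have "fan_subdivision ?\<Sigma> \<Sigma>"
    using subdiv fan_subdivision_stellar unfolding fan_subdivision_def by (metis order_trans)
  moreover have "inj_on (relabel p (set (\<tau> # Gs))) G"
  proof -
    have "inj_on (relabel p (set Gs) \<circ> f) G" using inj inj' fG by (intro comp_inj_on) auto
    moreover have "relabel p (set Gs) \<circ> f = relabel p (set (\<tau> # Gs))" using relabel by auto
    ultimately show ?thesis by metis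
  qed
  moreover have "factor_nested ?\<Sigma> (relabel p (set Gs) ` G') (relabel p (set Gs) ` (f ` N)) \<longleftrightarrow> factor_nested \<Sigma> G N"
    if N: "N \<subseteq> G" for N
  proof -
    have "f ` N \<subseteq> G'" using N fG by blast
    then have "factor_nested ?\<Sigma> (relabel p (set Gs) ` G') (relabel p (set Gs) ` (f ` N)) \<longleftrightarrow>
        factor_nested \<Sigma>' G' (f ` N)" using nest by blast
    also have "\<dots> \<longleftrightarrow> factor_nested \<Sigma> G N" using factor_nested_stellar[OF N] unfolding f_def .
    finally show ?thesis .
  qed
  ultimately show ?case
    using gb' unfolding relabel_image fG stellar_subdivisions.simps by blast
qed

section \<open>Building sets of rays\<close>

lemma ray_subset_eq:
  assumes "y \<noteq> 0" "convex_cone hull {y} \<subseteq> convex_cone hull {y'}"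
  shows "convex_cone hull {y} = convex_cone hull {y'}"
proof -
  have "y \<in> convex_cone hull {y'}" using assms(2) hull_inc[of y "{y}" convex_cone] by blast
  then obtain c where c: "c \<ge> 0" "y = c *\<^sub>R y'" unfolding convex_cone_hull_singleton by blast
  then have "y' = (1/c) *\<^sub>R y" using assms(1) by auto
  moreover have "(1/c) *\<^sub>R y \<in> convex_cone hull {y}" using c(1) by (intro convex_cone_hull_mul hull_inc) auto
  ultimately have "convex_cone hull {y'} \<subseteq> convex_cone hull {y}"
    using convex_cone_convex_cone_hull by (intro hull_minimal) auto
  then show ?thesis using assms(2) by blast
qed

text \<open>The positive and negative parts of a linear relation among the generators are two
  representations of one point of \<sigma>. Uniqueness makes them agree term by term, so every
  coefficient is 0.\<close>

lemma direct_sum_rays_simplicial: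
  fixes \<sigma> :: "'a::euclidean_space set"
  assumes ds: "direct_sum A \<sigma>" and \<sigma>: "convex_cone \<sigma>"
    and rays: "\<And>a. a \<in> A \<Longrightarrow> \<exists>y. y \<noteq> 0 \<and> a = convex_cone hull {y}"
  shows "\<exists>B. independent B \<and> \<sigma> = convex_cone hull B"
proof -
  obtain y where y: "\<And>a. a \<in> A \<Longrightarrow> y a \<noteq> 0" "\<And>a. a \<in> A \<Longrightarrow> a = convex_cone hull {y a}"
    using rays by metis
  have fin: "finite A" using ds unfolding direct_sum_def by blast
  have ya: "c *\<^sub>R y a \<in> a" if "a \<in> A" "c \<ge> 0" for a c
    using y(2)[OF that(1)] that(2) convex_cone_hull_singleton[of "y a"] by blast
  have cc: "convex_cone a" if "a \<in> A" for a
    using y(2)[OF that] convex_cone_convex_cone_hull by metis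
  have inj: "inj_on y A" using y(2) by (metis inj_onI)
  have "independent (y ` A)"
  proof (rule independent_if_scalars_zero)
    show "finite (y ` A)" using fin by simp
    fix f x assume f: "(\<Sum>x\<in>y ` A. f x *\<^sub>R x) = 0" and "x \<in> y ` A"
    then obtain a where a: "a \<in> A" "x = y a" by blast
    define u where "u a = max 0 (f (y a)) *\<^sub>R y a" for a
    define v where "v a = max 0 (- f (y a)) *\<^sub>R y a" for a
    have uv: "u a - v a = f (y a) *\<^sub>R y a" for a
      unfolding u_def v_def by (simp add: scaleR_diff_left[symmetric] max_def)
    have "sum u A - sum v A = (\<Sum>a\<in>A. f (y a) *\<^sub>R y a)"
      unfolding sum_subtractf[symmetric] uv ..
    also have "\<dots> = 0" using f inj by (simp add: sum.reindex)
    finally have "sum u A = sum v A" by simp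
    moreover have "u a \<in> a" "v a \<in> a" if "a \<in> A" for a
      unfolding u_def v_def by (rule ya[OF that max.cobounded1])+
    ultimately have "u a = v a" using direct_sum_unique[OF ds, of u v a] a(1) by blast
    then show "f x = 0" using uv[of a] y(1)[OF a(1)] a(2) by simp
  qed
  moreover have "\<sigma> = convex_cone hull (y ` A)"
  proof
    have "a \<subseteq> convex_cone hull (y ` A)" if a: "a \<in> A" for a
    proof -
      have "convex_cone hull {y a} \<subseteq> convex_cone hull (y ` A)" using a by (intro hull_mono) auto
      then show ?thesis using y(2)[OF a] by simp
    qed
    then show "\<sigma> \<subseteq> convex_cone hull (y ` A)"
      using direct_sum_subset[OF ds convex_cone_convex_cone_hull] by blast
    have "y a \<in> \<sigma>" if "a \<in> A" for a
      using direct_sum_summand[OF ds cc that] ya[OF that, of 1] by auto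
    then show "convex_cone hull (y ` A) \<subseteq> \<sigma>" using \<sigma> by (intro hull_minimal) auto
  qed
  ultimately show ?thesis by blast
qed

context
  fixes \<Sigma> :: "'a::euclidean_space set set" and G :: "'a set set"
  assumes gb: "geometric_building_set \<Sigma> G"
    and rays: "\<And>g. g \<in> G \<Longrightarrow> \<exists>y. y \<noteq> 0 \<and> g = convex_cone hull {y}"
begin

lemma rays_simplicial: "simplicial_fan \<Sigma>"
proof -
  have "\<exists>B. independent B \<and> \<sigma> = convex_cone hull B" if \<sigma>: "\<sigma> \<in> \<Sigma>" for \<sigma>
  proof (rule direct_sum_rays_simplicial[OF gb_direct_sum[OF gb \<sigma>] fan_convex_cone[OF gb_fan[OF gb] \<sigma>]])
    fix a assume "a \<in> factors G \<sigma>"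
    then show "\<exists>y. y \<noteq> 0 \<and> a = convex_cone hull {y}" using rays factors_subset by blast
  qed
  then show ?thesis using gb_fan[OF gb] unfolding simplicial_fan_def by blast
qed

lemma rays_antichain: "antichain G"
  unfolding antichain_def using rays ray_subset_eq by metis

lemma rays_factors: "factors G z = {g \<in> G. g \<subseteq> z}"
  using rays_antichain unfolding factors_def antichain_def by auto

text \<open>A set of rays is an antichain, so \<open>N\<close> itself must be a set of factors;
  conversely all subsets of a set of factors are sets of factors.\<close>

lemma rays_factor_nested_iff: "factor_nested \<Sigma> G N \<longleftrightarrow> (\<exists>z\<in>\<Sigma>. factors G z = N)"
proof
  assume "factor_nested \<Sigma> G N"
  then show "\<exists>z\<in>\<Sigma>. factors G z = N"
    using antichain_subset[OF rays_antichain] unfolding factor_nested_def by blast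
next
  assume "\<exists>z\<in>\<Sigma>. factors G z = N"
  then obtain z where z: "z \<in> \<Sigma>" "factors G z = N" by blast
  then show "factor_nested \<Sigma> G N"
    using subset_factors[OF gb z(1)] factors_subset unfolding factor_nested_def by blast
qed

lemma rays_factors_subset_iff:
  assumes "z \<in> \<Sigma>" "z' \<in> \<Sigma>"
  shows "factors G z \<subseteq> factors G z' \<longleftrightarrow> z \<subseteq> z'"
proof
  assume "factors G z \<subseteq> factors G z'"
  then show "z \<subseteq> z'"
    using gb_subset_convex_cone[OF gb assms(1) fan_convex_cone[OF gb_fan[OF gb] assms(2)]] factors_le by blast
qed (auto simp: rays_factors)

end

theorem theorem4p10:
  fixes \<Sigma> :: "'a::euclidean_space set set"
    and \<G> :: "'a set set"
    and Gs :: "'a set list"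
    and p :: "'a set \<Rightarrow> 'a"
  assumes "polyhedral_fan \<Sigma>"
    and "building_set \<Sigma> \<G>"
    and "nonincreasing_enumeration \<G> Gs"
    and "\<And>G. G \<in> \<G> \<Longrightarrow> p G \<in> rel_interior G"
  shows "(\<forall>i<length Gs.
            stellar_admissible (stellar_subdivisions p (take i Gs) \<Sigma>) (Gs ! i) (p (Gs ! i)))
       \<and> simplicial_fan (stellar_subdivisions p Gs \<Sigma>)
       \<and> fan_subdivision (stellar_subdivisions p Gs \<Sigma>) \<Sigma>
       \<and> order_isomorphic (stellar_subdivisions p Gs \<Sigma>) (nested_complex \<Sigma> \<G>)"
proof -
  have gb: "geometric_building_set \<Sigma> \<G>" using building_set_geometric assms(1,2) .
  have Gs: "set Gs = \<G>" "distinct Gs"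
    and order: "\<And>i j. i < length Gs \<Longrightarrow> j < length Gs \<Longrightarrow> Gs ! j \<subset> Gs ! i \<Longrightarrow> i < j"
    using assms(3) unfolding nonincreasing_enumeration_def by auto
  have sorted: "sorted_wrt (\<lambda>a b. \<not> a \<subset> b) Gs"
    unfolding sorted_wrt_iff_nth_less using order by (meson less_trans not_less_iff_gr_or_eq)
  define \<Sigma>n where "\<Sigma>n = stellar_subdivisions p Gs \<Sigma>"
  define r where "r = relabel p \<G>"
  define H where "H = r ` \<G>"
  \<comment> \<open>The list exhausts \<open>\<G>\<close>, so at the start the condition on unlisted
    elements is vacuous.\<close>
  have adm: "\<forall>i<length Gs.
            stellar_admissible (stellar_subdivisions p (take i Gs) \<Sigma>) (Gs ! i) (p (Gs ! i))"
    and gb': "geometric_building_set \<Sigma>n H"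
    and subdiv: "fan_subdivision \<Sigma>n \<Sigma>"
    and inj: "inj_on r \<G>"
    and nest: "\<And>N. N \<subseteq> \<G> \<Longrightarrow> factor_nested \<Sigma>n H (r ` N) \<longleftrightarrow> factor_nested \<Sigma> \<G> N"
    using iterated_stellar[OF gb _ Gs(2) sorted, of p] assms(4) Gs(1)
    unfolding \<Sigma>n_def H_def r_def by auto
  have rays: "\<exists>y. y \<noteq> 0 \<and> h = convex_cone hull {y}" if h: "h \<in> H" for h
  proof -
    obtain g where g: "g \<in> \<G>" "h = convex_cone hull {p g}" using h unfolding H_def r_def relabel_def by auto
    then have "p g \<noteq> 0"
      using fan_rel_interior_nonzero[OF assms(1) gb_subset[OF gb g(1)] assms(4)[OF g(1)]] by blast
    then show ?thesis using g(2) by blast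
  qed
  \<comment> \<open>The isomorphism: a cone of the final fan goes to the original elements whose
    rays it contains. Taking labels in \<open>\<G>\<close> rather than rays in \<open>H\<close>
    lands in nested sets of \<Sigma>, and injectivity of \<open>r\<close> makes the labels
    unambiguous.\<close>
  define F where "F z = {g \<in> \<G>. r g \<subseteq> z}" for z
  have rF: "r ` F z = factors H z" for z
  proof -
    have "factors H z = {h \<in> H. h \<subseteq> z}" by (rule rays_factors[OF gb' rays])
    then show ?thesis unfolding F_def H_def by auto
  qed
  have mono: "z \<subseteq> z' \<longleftrightarrow> F z \<subseteq> F z'" if z: "z \<in> \<Sigma>n" "z' \<in> \<Sigma>n" for z z'
  proof -
    have "F z \<subseteq> F z' \<longleftrightarrow> r ` F z \<subseteq> r ` F z'"
      using inj_on_image_subset_iff[OF inj, of "F z" "F z'"] unfolding F_def by blast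
    then show ?thesis using rays_factors_subset_iff[OF gb' rays z] unfolding rF by blast
  qed
  have nested: "N \<in> nested_complex \<Sigma> \<G> \<longleftrightarrow> N \<subseteq> \<G> \<and> (\<exists>z\<in>\<Sigma>n. factors H z = r ` N)" for N
  proof -
    have "N \<subseteq> \<G>" if "factor_nested \<Sigma> \<G> N" using that unfolding factor_nested_def by blast
    then show ?thesis
      unfolding nested_complex_def mem_Collect_eq nested_iff_factor_nested[OF gb]
      using nest[of N] rays_factor_nested_iff[OF gb' rays] by blast
  qed
  have "bij_betw F \<Sigma>n (nested_complex \<Sigma> \<G>)"
    unfolding bij_betw_def
  proof (intro conjI equalityI subsetI)
    show "inj_on F \<Sigma>n" using mono by (intro inj_onI) (simp add: subset_antisym)
    show "N \<in> nested_complex \<Sigma> \<G>" if N: "N \<in> F ` \<Sigma>n" for N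
    proof -
      obtain z where z: "z \<in> \<Sigma>n" "N = F z" using N by blast
      have "F z \<subseteq> \<G>" unfolding F_def by blast
      then show ?thesis unfolding nested z(2) using z(1) rF[of z] by metis
    qed
    fix N assume "N \<in> nested_complex \<Sigma> \<G>"
    then obtain z where z: "N \<subseteq> \<G>" "z \<in> \<Sigma>n" "factors H z = r ` N" unfolding nested by blast
    have "F z \<subseteq> \<G>" unfolding F_def by blast
    then have "F z = N" using inj_on_image_eq_iff[OF inj _ z(1), of "F z"] rF[of z] z(3) by simp
    then show "N \<in> F ` \<Sigma>n" using z(2) by blast
  qed
  then have "order_iso F \<Sigma>n (nested_complex \<Sigma> \<G>)" using mono unfolding order_iso_def by blast
  then show ?thesis
    using adm subdiv rays_simplicial[OF gb' rays] unfolding order_isomorphic_def \<Sigma>n_def by blast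
qed

end
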